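(* Let $a\ge 1$, $l\ge 2$, $1\le h\le l-1$, and $n=a+l+1$. Let $K_a^l$ be the lollipop consisting of a complete graph $K_a$ together with a path $v_0v_1\cdots v_l$ of length $l$ where $v_0$ is a vertex of $K_a$ and $v_1,\dots,v_l$ are new vertices. Let $\mathrm{tw}_h(K_a^l)$ be the graph obtained from $K_a^l$ by adding a new vertex adjacent to $v_{l-h}$ and to all neighbors of $v_{l-h}$ (i.e. to $v_{l-h-1},v_{l-h},v_{l-h+1}$). Then \begin{align*} \frac{X_{\mathrm{tw}_h(K_a^l)}}{2(a-1)!}&=\sum_{\substack{K\vDash n,\ k_{-1}\ge a\\ \Theta_K(h)\ge 3}}2w_Ke_K+\sum_{\substack{I\vDash n-1,\ i_{-1}\ge a\\ \Theta_I(h)\ge 3}}w_Ie_{1I}+\sum_{\substack{K\vDash n,\ \Theta_K(h)\le 1,\ k_{-1}\ge 3\\ k_{-1}+k_{-2}\ge n-h+1\text{ or }k_{-2}\ge a}}(k_{-1}-2)w_{K\setminus k_{-1}}e_K\\ &\quad+\sum_{K\vDash n,\ k_{-1}\ge a,\ \Theta_K(h+3)\ge\Theta_K(h)=2}\frac{\Theta_K(h+3)-1}{\Theta_K(h+3)}w_Ke_K. \end{align*}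
   Context: $X_G=\sum_\kappa\prod_{v\in V(G)}x_{\kappa(v)}$ summed over proper colorings $\kappa:V(G)\to\{1,2,\dots\}$. A composition $K=k_1\cdots k_l\vDash n$ is a sequence of positive integers with sum $n$, of length $l$; $k_{-j}=k_{l+1-j}$ (conditions involving $k_{-2}$ refer to compositions of length at least 2); $K\setminus k_{-1}$ is $K$ with its last part removed; $1I$ is the composition obtained by prepending a part $1$ to $I$. $e_K=e_{k_1}\cdots e_{k_l}$ with $e_k$ elementary symmetric functions. $w_K=k_1(k_2-1)\cdots(k_l-1)$. For $0\le c\le n$, $\sigma_K(c)=\min\{k_1+\dots+k_j:0\le j\le l,\ k_1+\dots+k_j\ge c\}$ and $\Theta_K(c)=\sigma_K(c)-c$. *)

theory Defs
  imports Complex_Main "HOL-Library.Poly_Mapping" "HOL-Library.FuncSet"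
begin

section \<open>Formal power series in countably many variables\<close>

text \<open>A monomial in the variables \<open>x\<^sub>0, x\<^sub>1, x\<^sub>2, \<dots>\<close> is a finitely supported exponent vector;
  a series is an arbitrary family of coefficients, so infinite sums of distinct monomials
  (such as chromatic symmetric functions) are allowed.
  Only the variables \<open>x\<^sub>i\<close> with \<open>i \<ge> 1\<close> are used below.\<close>

typedef 'a mfps = "UNIV :: ((nat \<Rightarrow>\<^sub>0 nat) \<Rightarrow> 'a) set"
  morphisms mcoeff Abs_mfps ..

setup_lifting type_definition_mfps

lemma mfps_eqI: "(\<And>m. mcoeff f m = mcoeff g m) \<Longrightarrow> f = g"
  by transfer auto

definition splits :: "(nat \<Rightarrow>\<^sub>0 nat) \<Rightarrow> ((nat \<Rightarrow>\<^sub>0 nat) \<times> (nat \<Rightarrow>\<^sub>0 nat)) set" where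
  "splits m = {(p, q). p + q = m}"

lemma finite_splits [simp]: "finite (splits m)"
proof -
  define k where "k = Poly_Mapping.keys m"
  define B where "B = (\<Union>i\<in>k. {..Poly_Mapping.lookup m i})"
  have fin: "finite {f. \<forall>i. (i \<in> k \<longrightarrow> f i \<in> B) \<and> (i \<notin> k \<longrightarrow> f i = 0)}"
    by (rule finite_set_of_finite_funs) (simp_all add: k_def B_def)
  have "Poly_Mapping.lookup ` fst ` splits m \<subseteq> {f. \<forall>i. (i \<in> k \<longrightarrow> f i \<in> B) \<and> (i \<notin> k \<longrightarrow> f i = 0)}"
  proof clarify
    fix p q :: "nat \<Rightarrow>\<^sub>0 nat" and i
    assume "(p, q) \<in> splits m"
    then have "Poly_Mapping.lookup m i = Poly_Mapping.lookup p i + Poly_Mapping.lookup q i"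
      by (auto simp: splits_def lookup_add)
    then have le: "Poly_Mapping.lookup p i \<le> Poly_Mapping.lookup m i"
      by simp
    show "(i \<in> k \<longrightarrow> Poly_Mapping.lookup (fst (p, q)) i \<in> B) \<and> (i \<notin> k \<longrightarrow> Poly_Mapping.lookup (fst (p, q)) i = 0)"
    proof (intro conjI impI)
      assume "i \<in> k"
      then show "Poly_Mapping.lookup (fst (p, q)) i \<in> B"
        unfolding B_def using le by auto
    next
      assume "i \<notin> k"
      then have "Poly_Mapping.lookup m i = 0"
        by (simp add: k_def in_keys_iff)
      then show "Poly_Mapping.lookup (fst (p, q)) i = 0"
        using le by simp
    qed
  qed
  then have "finite (Poly_Mapping.lookup ` fst ` splits m)"
    using fin by (rule finite_subset)
  then have "finite (fst ` splits m)"
    by (rule finite_imageD) (simp add: inj_on_def lookup_inject)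
  moreover have "inj_on fst (splits m)"
  proof (rule inj_onI)
    fix z z' assume "z \<in> splits m" "z' \<in> splits m" "fst z = fst z'"
    then have "fst z + snd z = fst z + snd z'"
      by (simp add: splits_def case_prod_unfold)
    with \<open>fst z = fst z'\<close> show "z = z'"
      by (simp add: prod_eq_iff)
  qed
  ultimately show ?thesis
    by (rule finite_imageD)
qed

instantiation mfps :: (comm_ring_1) comm_ring_1
begin

lift_definition zero_mfps :: "'a mfps" is "\<lambda>_. 0" .
lift_definition one_mfps :: "'a mfps" is "\<lambda>m. if m = 0 then 1 else 0" .
lift_definition plus_mfps :: "'a mfps \<Rightarrow> 'a mfps \<Rightarrow> 'a mfps" is "\<lambda>f g m. f m + g m" .
lift_definition minus_mfps :: "'a mfps \<Rightarrow> 'a mfps \<Rightarrow> 'a mfps" is "\<lambda>f g m. f m - g m" .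
lift_definition uminus_mfps :: "'a mfps \<Rightarrow> 'a mfps" is "\<lambda>f m. - f m" .
lift_definition times_mfps :: "'a mfps \<Rightarrow> 'a mfps \<Rightarrow> 'a mfps"
  is "\<lambda>f g m. \<Sum>(p, q)\<in>splits m. f p * g q" .

instance
proof
  fix f g h :: "'a mfps"
  show "f * g * h = f * (g * h)"
  proof (rule mfps_eqI)
    fix m
    have "mcoeff (f * g * h) m
        = (\<Sum>(r, s)\<in>splits m. \<Sum>(p, q)\<in>splits r. mcoeff f p * mcoeff g q * mcoeff h s)"
      by transfer (simp add: sum_distrib_right case_prod_unfold)
    also have "\<dots> = (\<Sum>((r, s), (p, q))\<in>(SIGMA z:splits m. splits (fst z)).
                     mcoeff f p * mcoeff g q * mcoeff h s)"
      by (simp add: sum.Sigma case_prod_unfold)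
    also have "\<dots> = (\<Sum>((p, r), (q, s))\<in>(SIGMA z:splits m. splits (snd z)).
                     mcoeff f p * (mcoeff g q * mcoeff h s))"
      by (rule sum.reindex_bij_witness
          [where i = "\<lambda>((p, r), (q, s)). ((p + q, s), (p, q))"
             and j = "\<lambda>((r, s), (p, q)). ((p, q + s), (q, s))"])
         (auto simp: splits_def add.assoc mult.assoc)
    also have "\<dots> = (\<Sum>(p, r)\<in>splits m. \<Sum>(q, s)\<in>splits r. mcoeff f p * (mcoeff g q * mcoeff h s))"
      by (simp add: sum.Sigma case_prod_unfold)
    also have "\<dots> = mcoeff (f * (g * h)) m"
      by transfer (simp add: sum_distrib_left case_prod_unfold)
    finally show "mcoeff (f * g * h) m = mcoeff (f * (g * h)) m" .
  qed
  show "f * g = g * f"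
  proof (transfer, rule ext)
    fix f g :: "(nat \<Rightarrow>\<^sub>0 nat) \<Rightarrow> 'a" and m
    show "(\<Sum>(p, q)\<in>splits m. f p * g q) = (\<Sum>(p, q)\<in>splits m. g p * f q)"
      by (rule sum.reindex_bij_witness [where i = prod.swap and j = prod.swap])
         (auto simp: splits_def add.commute mult.commute)
  qed
  show "1 * f = f"
  proof (transfer, rule ext)
    fix f :: "(nat \<Rightarrow>\<^sub>0 nat) \<Rightarrow> 'a" and m
    have "(\<Sum>(p, q)\<in>splits m. (if p = 0 then 1 else 0) * f q)
        = (\<Sum>(p, q)\<in>{(0 :: nat \<Rightarrow>\<^sub>0 nat, m)}. (if p = 0 then 1 else 0) * f q)"
      by (rule sum.mono_neutral_right) (simp, auto simp: splits_def split: if_splits)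
    then show "(\<Sum>(p, q)\<in>splits m. (if p = 0 then 1 else 0) * f q) = f m"
      by simp
  qed
  show "(f + g) * h = f * h + g * h"
    by transfer (simp add: case_prod_unfold distrib_right sum.distrib)
  show "f + g + h = f + (g + h)" "f + g = g + f" "0 + f = f" "- f + f = 0" "f - g = f + - g"
    by (transfer; simp add: algebra_simps)+
  show "(0 :: 'a mfps) \<noteq> 1"
    by transfer (auto simp: fun_eq_iff intro: exI [of _ 0])
qed

end

lift_definition mfps_smult :: "'a::comm_ring_1 \<Rightarrow> 'a mfps \<Rightarrow> 'a mfps" (infixr "\<odot>" 75)
  is "\<lambda>c f m. c * f m" .

text \<open>\<open>monom_of \<kappa> V\<close> is the monomial \<open>\<Prod>v\<in>V. x\<^bsub>\<kappa> v\<^esub>\<close>.\<close>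

definition monom_of :: "('v \<Rightarrow> nat) \<Rightarrow> 'v set \<Rightarrow> (nat \<Rightarrow>\<^sub>0 nat)" where
  "monom_of \<kappa> V = (\<Sum>v\<in>V. Poly_Mapping.single (\<kappa> v) 1)"

text \<open>\<open>e\<^sub>k = \<Sum> x\<^bsub>i1\<^esub> \<cdots> x\<^bsub>ik\<^esub>\<close> over \<open>1 \<le> i1 < \<dots> < ik\<close>: the coefficient at \<open>m\<close> is the number of
  \<open>k\<close>-subsets of the positive integers whose monomial is \<open>m\<close> (which is 0 or 1).\<close>

lift_definition esym :: "nat \<Rightarrow> 'a::comm_ring_1 mfps"
  is "\<lambda>k m. of_nat (card {S. S \<subseteq> {1..} \<and> finite S \<and> card S = k \<and> monom_of id S = m})" .

definition esym_comp :: "nat list \<Rightarrow> 'a::comm_ring_1 mfps" where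
  "esym_comp K = prod_list (map esym K)"


section \<open>Graphs and chromatic symmetric functions\<close>

text \<open>A graph is a pair of a vertex set and a set of two-element edges.\<close>

type_synonym 'v graph = "'v set \<times> 'v set set"

definition proper_colorings :: "'v graph \<Rightarrow> ('v \<Rightarrow> nat) set" where
  "proper_colorings G =
     {\<kappa> \<in> fst G \<rightarrow>\<^sub>E {1..}. \<forall>u v. {u, v} \<in> snd G \<longrightarrow> \<kappa> u \<noteq> \<kappa> v}"

text \<open>\<open>X\<^sub>G = \<Sum>\<kappa>. \<Prod>v\<in>V. x\<^bsub>\<kappa> v\<^esub>\<close>; the coefficient at \<open>m\<close> counts the proper colorings with monomial
  \<open>m\<close>, and there are finitely many of them when the vertex set is finite.\<close>

lift_definition chromatic_sym :: "'v graph \<Rightarrow> 'a::comm_ring_1 mfps"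
  is "\<lambda>G m. of_nat (card {\<kappa> \<in> proper_colorings G. monom_of \<kappa> (fst G) = m})" .

text \<open>The path vertex \<open>v\<^sub>j\<close> of the lollipop is the number \<open>a - 1 + j\<close>, so that the vertices of the
  complete graph are \<open>0, \<dots>, a - 1\<close> and \<open>v\<^sub>0 = a - 1\<close> is one of them (for \<open>a \<ge> 1\<close>).\<close>

definition path_vertex :: "nat \<Rightarrow> nat \<Rightarrow> nat" where
  "path_vertex a j = a - 1 + j"

definition lollipop :: "nat \<Rightarrow> nat \<Rightarrow> nat graph" where
  "lollipop a l =
     ({..<a} \<union> path_vertex a ` {1..l},
      {{i, j} | i j. i < a \<and> j < a \<and> i \<noteq> j}
      \<union> {{path_vertex a j, path_vertex a (j + 1)} | j. j < l})"

text \<open>\<open>twin G v u\<close> adds a new vertex \<open>u\<close> (assumed not to be in \<open>G\<close>) adjacent to \<open>v\<close> and to all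
  neighbors of \<open>v\<close>.\<close>

definition twin :: "'v graph \<Rightarrow> 'v \<Rightarrow> 'v \<Rightarrow> 'v graph" where
  "twin G v u = (insert u (fst G), snd G \<union> {{u, x} | x. x = v \<or> {v, x} \<in> snd G})"

definition twinned_lollipop :: "nat \<Rightarrow> nat \<Rightarrow> nat \<Rightarrow> nat graph" where
  "twinned_lollipop h a l = twin (lollipop a l) (path_vertex a (l - h)) (a + l)"

lemma new_vertex_notin_lollipop: "a \<ge> 1 \<Longrightarrow> a + l \<notin> fst (lollipop a l)"
  by (auto simp: lollipop_def path_vertex_def)


section \<open>Compositions\<close>

definition is_composition :: "nat list \<Rightarrow> nat \<Rightarrow> bool" (infix "\<Turnstile>" 50) where
  "K \<Turnstile> n \<longleftrightarrow> (\<forall>k\<in>set K. k \<ge> 1) \<and> sum_list K = n"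

lemma finite_compositions: "finite {K. K \<Turnstile> n}"
proof (rule finite_subset)
  have "length K \<le> sum_list K" if "\<forall>k\<in>set K. k \<ge> 1" for K :: "nat list"
    using that by (induction K) auto
  moreover have "k \<le> sum_list K" if "k \<in> set K" for k and K :: "nat list"
    by (rule member_le_sum_list) (use that in auto)
  ultimately show "{K. K \<Turnstile> n} \<subseteq> {K. set K \<subseteq> {..n} \<and> length K \<le> n}"
    unfolding is_composition_def by blast
  show "finite {K. set K \<subseteq> {..n} \<and> length K \<le> n}"
    by (rule finite_lists_length_le) simp
qed

text \<open>\<open>k\<^bsub>-j\<^esub> = k\<^bsub>l+1-j\<^esub>\<close> for \<open>1 \<le> j \<le> l\<close>; list positions are counted from 0.\<close>

definition part_end :: "nat list \<Rightarrow> nat \<Rightarrow> nat" where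
  "part_end K j = K ! (length K - j)"

text \<open>\<open>w\<^sub>K = k\<^sub>1 (k\<^sub>2 - 1) \<cdots> (k\<^sub>l - 1)\<close>; the truncated subtraction is harmless as parts are positive.\<close>

definition comp_weight :: "nat list \<Rightarrow> nat" where
  "comp_weight K = (case K of [] \<Rightarrow> 1 | k # ks \<Rightarrow> k * (\<Prod>j\<leftarrow>ks. j - 1))"

definition comp_sigma :: "nat list \<Rightarrow> nat \<Rightarrow> nat" where
  "comp_sigma K c = Min {s. \<exists>j\<le>length K. s = sum_list (take j K) \<and> s \<ge> c}"

text \<open>Meaningful for \<open>c \<le> sum_list K\<close>, in which case \<open>c \<le> comp_sigma K c\<close>.\<close>

definition comp_theta :: "nat list \<Rightarrow> nat \<Rightarrow> nat" where
  "comp_theta K c = comp_sigma K c - c"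

end

theory Submission
  imports Defs "HOL-Combinatorics.Multiset_Permutations"
begin

text \<open>Colorings are read as words, so relabelling vertices becomes permuting positions and disjoint
  unions become concatenation. Triple deletion at the two triangles of the twinned vertex expresses
  \<open>X / 2\<close>, with \<open>m = n - h\<close> and \<open>L\<^sub>N\<close>, \<open>P\<^sub>N\<close> the chromatic functions of the lollipop of \<open>K\<^sub>a\<close> and of the
  path on \<open>N\<close> vertices, as
  \<open>2 L\<^sub>n + e\<^sub>1 L\<^bsub>n-1\<^esub> - L\<^sub>m P\<^sub>h - L\<^bsub>m-1\<^esub> P\<^bsub>h+1\<^esub> - L\<^bsub>m-2\<^esub> (P\<^bsub>h+2\<^esub> - e\<^sub>2 P\<^sub>h)\<close>,
  and \<open>L\<^sub>N = (a-1)! \<Sum> w\<^sub>K e\<^sub>K\<close> over the compositions \<open>K\<close> of \<open>N\<close> with last part at least \<open>a\<close>.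
  Cutting each \<open>K\<close> with \<open>\<Theta>\<^sub>K(h) = t \<le> 2\<close> right after the part that crosses \<open>h\<close>, the prefixes
  contribute \<open>P\<^sub>h\<close>, \<open>P\<^bsub>h+1\<^esub>\<close> and \<open>P\<^bsub>h+2\<^esub> - e\<^sub>2 P\<^sub>h\<close> for \<open>t = 0, 1, 2\<close>, which are exactly the factors above. So
  the negative terms cancel prefix by prefix, leaving tails \<open>R\<close> weighted by
  \<open>(r\<^sub>1 - 2) (r\<^sub>2 - 1) (r\<^sub>3 - 1) \<cdots>\<close>; the third sum arises for \<open>t \<le> 1\<close> by moving \<open>r\<^sub>1\<close> to the end.\<close>

section \<open>Generating functions of words\<close>

lemma mcoeff_add: "mcoeff (f + g) m = mcoeff f m + mcoeff g m"
  by transfer simp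

lemma mcoeff_0: "mcoeff 0 m = 0"
  by transfer simp

lemma mcoeff_of_nat_mult: "mcoeff (of_nat c * f) m = of_nat c * mcoeff f m"
  by (induction c) (simp_all add: mcoeff_0 mcoeff_add algebra_simps)

lemma smult_of_nat: "of_nat c \<odot> f = of_nat c * f"
  by (rule mfps_eqI) (simp add: mcoeff_of_nat_mult mfps_smult.rep_eq)

definition word_monom :: "nat list \<Rightarrow> (nat \<Rightarrow>\<^sub>0 nat)" where
  "word_monom xs = (\<Sum>i\<leftarrow>xs. Poly_Mapping.single i 1)"

lemma word_monom_append: "word_monom (xs @ ys) = word_monom xs + word_monom ys"
  by (simp add: word_monom_def)

lemma lookup_word_monom: "Poly_Mapping.lookup (word_monom xs) i = count_list xs i"
  by (induction xs) (auto simp: word_monom_def lookup_add lookup_single when_def)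

lemma word_monom_eq_iff: "word_monom xs = word_monom ys \<longleftrightarrow> mset xs = mset ys"
  by (simp add: poly_mapping_eq_iff fun_eq_iff lookup_word_monom multiset_eq_iff count_mset)

text \<open>All words with a given monomial are rearrangements of one of them. Finiteness matters
  because the sum in \<open>list_gf\<close> would be 0 by convention over an infinite set.\<close>

lemma finite_word_monom: "finite {xs. word_monom xs = m}"
proof (cases "\<exists>ys. word_monom ys = m")
  case True
  then obtain ys where ys: "word_monom ys = m" by blast
  have "{xs. word_monom xs = m} = permutations_of_multiset (mset ys)"
    using ys word_monom_eq_iff by (auto simp: permutations_of_multiset_def)
  then show ?thesis by simp
next
  case False
  then show ?thesis by simp
qed

lift_definition list_gf :: "(nat list \<Rightarrow> 'a::comm_ring_1) \<Rightarrow> 'a mfps"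
  is "\<lambda>f m. \<Sum>xs | word_monom xs = m. f xs" .

lemma list_gf_add: "list_gf (\<lambda>xs. f xs + g xs) = list_gf f + list_gf g"
  by transfer (simp add: sum.distrib)

lemma list_gf_sum: "list_gf (\<lambda>xs. \<Sum>i\<in>I. f i xs) = (\<Sum>i\<in>I. list_gf (f i))"
proof (induction I rule: infinite_finite_induct)
  case (insert i I)
  then show ?case by (simp add: list_gf_add)
qed (transfer; simp)+

text \<open>Preserving the multiset keeps a word among those of its monomial, and an injection of a
  finite set into itself is onto.\<close>

lemma list_gf_permute:
  assumes "inj \<pi>" and "\<And>xs. mset (\<pi> xs) = mset xs"
  shows "list_gf (\<lambda>xs. f (\<pi> xs)) = list_gf f"
proof (rule mfps_eqI)
  fix m
  let ?S = "{xs. word_monom xs = m}"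
  have "\<pi> ` ?S \<subseteq> ?S"
    using assms(2) word_monom_eq_iff by fastforce
  then have "\<pi> ` ?S = ?S"
    by (intro endo_inj_surj finite_word_monom inj_on_subset[OF assms(1)]) auto
  then have "bij_betw \<pi> ?S ?S"
    using assms(1) by (auto simp: bij_betw_def intro: inj_on_subset)
  then show "mcoeff (list_gf (\<lambda>xs. f (\<pi> xs))) m = mcoeff (list_gf f) m"
    unfolding list_gf.rep_eq by (rule sum.reindex_bij_betw)
qed

text \<open>Excluding the letter 0 restricts the colors to the positive integers.\<close>

definition words_gf :: "nat \<Rightarrow> (nat list \<Rightarrow> bool) \<Rightarrow> 'a::comm_ring_1 mfps" where
  "words_gf N p = list_gf (\<lambda>xs. of_bool (length xs = N \<and> 0 \<notin> set xs \<and> p xs))"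

lemma words_gf_cong:
  assumes "\<And>xs. length xs = N \<Longrightarrow> p xs = q xs"
  shows "words_gf N p = words_gf N q"
proof -
  have "(length xs = N \<and> 0 \<notin> set xs \<and> p xs) = (length xs = N \<and> 0 \<notin> set xs \<and> q xs)" for xs
    using assms by auto
  then show ?thesis unfolding words_gf_def by simp
qed

lemma mcoeff_words_gf:
  "mcoeff (words_gf N p) m =
     of_nat (card {xs. word_monom xs = m \<and> length xs = N \<and> 0 \<notin> set xs \<and> p xs})"
proof -
  have "(\<Sum>xs | word_monom xs = m. of_bool (length xs = N \<and> 0 \<notin> set xs \<and> p xs)) =
    (of_nat (card ({xs. word_monom xs = m} \<inter> {xs. length xs = N \<and> 0 \<notin> set xs \<and> p xs})) :: 'a)"
    by (simp add: sum_of_bool_eq finite_word_monom)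
  moreover have "{xs. word_monom xs = m} \<inter> {xs. length xs = N \<and> 0 \<notin> set xs \<and> p xs} =
      {xs. word_monom xs = m \<and> length xs = N \<and> 0 \<notin> set xs \<and> p xs}" by auto
  ultimately show ?thesis by (simp add: words_gf_def list_gf.rep_eq)
qed

text \<open>A word of length \<open>k + m\<close> splits uniquely after \<open>k\<close> letters,
  and its monomial is the product of those of the two pieces. For colorings this is the disjoint
  union of two graphs.\<close>

lemma words_gf_mult:
  "words_gf k p * words_gf m q = words_gf (k + m) (\<lambda>z. p (take k z) \<and> q (drop k z))"
proof (rule mfps_eqI)
  fix M
  let ?A = "\<lambda>m. {xs. word_monom xs = m \<and> length xs = k \<and> 0 \<notin> set xs \<and> p xs}"
  let ?B = "\<lambda>M. {xs. word_monom xs = M \<and> length xs = m \<and> 0 \<notin> set xs \<and> q xs}"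
  let ?C = "{xs. word_monom xs = M \<and> length xs = k + m \<and> 0 \<notin> set xs
      \<and> p (take k xs) \<and> q (drop k xs)}"
  have fin: "finite (?A u)" "finite (?B u)" for u
    by (rule finite_subset[OF _ finite_word_monom[of u]], auto)+
  have "bij_betw (\<lambda>(z, xs, ys). xs @ ys)
      (SIGMA z:splits M. ?A (fst z) \<times> ?B (snd z)) ?C"
  proof (rule bij_betwI[where g = "\<lambda>zs. ((word_monom (take k zs), word_monom (drop k zs)),
          take k zs, drop k zs)"])
    show "(\<lambda>(z, xs, ys). xs @ ys) \<in> (SIGMA z:splits M. ?A (fst z) \<times> ?B (snd z)) \<rightarrow> ?C"
      by (auto simp: splits_def word_monom_append)
    have "word_monom (take k zs) + word_monom (drop k zs) = word_monom zs" for zs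
      by (metis append_take_drop_id word_monom_append)
    then show "(\<lambda>zs. ((word_monom (take k zs), word_monom (drop k zs)), take k zs, drop k zs))
        \<in> ?C \<rightarrow> (SIGMA z:splits M. ?A (fst z) \<times> ?B (snd z))"
      by (auto simp: splits_def dest: in_set_takeD in_set_dropD)
  qed auto
  from bij_betw_same_card[OF this]
  have "card ?C = card (SIGMA z:splits M. ?A (fst z) \<times> ?B (snd z))" by (rule sym)
  also have "\<dots> = (\<Sum>z\<in>splits M. card (?A (fst z) \<times> ?B (snd z)))"
    by (rule card_SigmaI) (intro finite_splits ballI finite_cartesian_product fin)+
  also have "\<dots> = (\<Sum>z\<in>splits M. card (?A (fst z)) * card (?B (snd z)))"
    by (simp only: card_cartesian_product)
  finally have C: "card ?C = (\<Sum>z\<in>splits M. card (?A (fst z)) * card (?B (snd z)))" .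
  show "mcoeff (words_gf k p * words_gf m q) M =
      mcoeff (words_gf (k + m) (\<lambda>z. p (take k z) \<and> q (drop k z)) :: 'a mfps) M"
    unfolding times_mfps.rep_eq mcoeff_words_gf C by (simp add: case_prod_unfold)
qed

text \<open>Leaving the word unchanged when a position is out of range makes this an involution on
  all lists, as the global injectivity in \<open>list_gf_permute\<close> requires.\<close>

definition swap_at :: "nat \<Rightarrow> nat \<Rightarrow> nat list \<Rightarrow> nat list" where
  "swap_at i j xs = (if i < length xs \<and> j < length xs then xs[i := xs ! j, j := xs ! i] else xs)"

lemma length_swap_at [simp]: "length (swap_at i j xs) = length xs"
  by (simp add: swap_at_def)

lemma mset_swap_at [simp]: "mset (swap_at i j xs) = mset xs"
  by (simp add: swap_at_def mset_swap)

lemma set_swap_at [simp]: "set (swap_at i j xs) = set xs"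
  by (metis mset_swap_at set_mset_mset)

lemma swap_at_swap_at [simp]: "swap_at i j (swap_at i j xs) = xs"
  by (auto simp: swap_at_def list_eq_iff_nth_eq nth_list_update)

lemma words_gf_swap: "words_gf N (\<lambda>xs. p (swap_at i j xs)) = words_gf N p"
proof -
  have "inj (swap_at i j)" by (metis injI swap_at_swap_at)
  then have "list_gf (\<lambda>xs. (\<lambda>xs. of_bool (length xs = N \<and> 0 \<notin> set xs \<and> p xs)) (swap_at i j xs))
      = list_gf (\<lambda>xs. of_bool (length xs = N \<and> 0 \<notin> set xs \<and> p xs))"
    by (rule list_gf_permute) simp
  then show ?thesis by (simp add: words_gf_def)
qed

text \<open>Moving the letter at position \<open>k\<close> to the end relabels the vertices. It
  serves to bring the twin, stored last, next to the vertex it copies, and to carry an isolated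
  vertex to the end of the word.\<close>

lemma words_gf_rotate_drop:
  "words_gf N (\<lambda>xs. p (take k xs @ rotate1 (drop k xs))) = words_gf N p"
proof -
  let ?\<pi> = "\<lambda>xs :: nat list. take k xs @ rotate1 (drop k xs)"
  have inj: "inj ?\<pi>"
  proof (rule injI)
    fix xs ys :: "nat list"
    assume eq: "?\<pi> xs = ?\<pi> ys"
    then have "length (?\<pi> xs) = length (?\<pi> ys)" by simp
    then have "length xs = length ys" by simp
    with eq have "take k xs = take k ys \<and> rotate1 (drop k xs) = rotate1 (drop k ys)"
      by (subst (asm) append_eq_append_conv) auto
    then have "take k xs = take k ys \<and> drop k xs = drop k ys"
      by (metis injD inj_rotate1)
    then show "xs = ys" by (metis append_take_drop_id)
  qed
  have ms: "mset (?\<pi> xs) = mset xs" for xs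
  proof -
    have "mset (rotate1 ys) = mset ys" for ys :: "nat list" by (cases ys) auto
    then show ?thesis by (metis append_take_drop_id mset_append)
  qed
  have st: "set (?\<pi> xs) = set xs" for xs
    by (metis ms set_mset_mset)
  have lg: "length (?\<pi> xs) = length xs" for xs
    by simp
  have "list_gf (\<lambda>xs. (\<lambda>xs. of_bool (length xs = N \<and> 0 \<notin> set xs \<and> p xs)) (?\<pi> xs))
      = list_gf (\<lambda>xs. of_bool (length xs = N \<and> 0 \<notin> set xs \<and> p xs))"
    by (rule list_gf_permute) (rule inj, rule ms)
  then show ?thesis unfolding words_gf_def st lg .
qed

text \<open>This is the complete graph: each set of \<open>k\<close> colors is used in
  \<open>fact k\<close> orders.\<close>

lemma words_gf_distinct: "words_gf k distinct = of_nat (fact k) * esym k"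
proof (rule mfps_eqI)
  fix m
  let ?S = "{S. S \<subseteq> {1..} \<and> finite S \<and> card S = k \<and> monom_of id S = m}"
  have mon: "word_monom xs = monom_of id (set xs)" if "distinct xs" for xs
    using that by (simp add: word_monom_def monom_of_def sum_list_distinct_conv_sum_set)
  have fin: "finite ?S"
  proof (rule finite_subset)
    show "?S \<subseteq> set ` {xs. word_monom xs = m}"
    proof
      fix S assume S: "S \<in> ?S"
      then obtain xs where "set xs = S" "distinct xs" using finite_distinct_list by blast
      with S mon[of xs] show "S \<in> set ` {xs. word_monom xs = m}" by auto
    qed
  qed (simp add: finite_word_monom)
  have "{xs. word_monom xs = m \<and> length xs = k \<and> 0 \<notin> set xs \<and> distinct xs} =
      (\<Union>S\<in>?S. permutations_of_set S)"
    by (force simp: permutations_of_set_def mon distinct_card Suc_le_eq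
        intro: gr0I)
  also have "card \<dots> = (\<Sum>S\<in>?S. card (permutations_of_set S))"
    by (rule card_UN_disjoint[OF fin]) (simp, auto simp: permutations_of_set_def)
  also have "\<dots> = (\<Sum>S\<in>?S. fact k)"
    by (rule sum.cong) auto
  finally have "card {xs. word_monom xs = m \<and> length xs = k \<and> 0 \<notin> set xs \<and> distinct xs} =
      fact k * card ?S" by simp
  then show "mcoeff (words_gf k distinct) m = mcoeff (of_nat (fact k) * esym k :: 'a mfps) m"
    by (simp add: mcoeff_words_gf mcoeff_of_nat_mult esym.rep_eq del: of_nat_fact)
qed

section \<open>Lollipops\<close>

text \<open>Position \<open>a - 1\<close> is the vertex \<open>v_0\<close>: it belongs to the clique
  \<open>take a xs\<close> and also starts the path \<open>drop (a - 1) xs\<close>.\<close>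

definition lollipop_word :: "nat \<Rightarrow> nat list \<Rightarrow> bool" where
  "lollipop_word a xs \<longleftrightarrow> distinct (take a xs) \<and> distinct_adj (drop (a - 1) xs)"

definition lollipop_gf :: "nat \<Rightarrow> nat \<Rightarrow> 'a::comm_ring_1 mfps" where
  "lollipop_gf a N = words_gf N (lollipop_word a)"

lemma lollipop_word_1 [simp]: "lollipop_word (Suc 0) = distinct_adj"
proof
  show "lollipop_word (Suc 0) xs = distinct_adj xs" for xs
    by (cases xs) (simp_all add: lollipop_word_def)
qed

lemma lollipop_word_append:
  assumes "1 \<le> a" "a \<le> length xs"
  shows "lollipop_word a (xs @ ys) \<longleftrightarrow>
     lollipop_word a xs \<and> distinct_adj ys \<and> (ys = [] \<or> last xs \<noteq> hd ys)"
proof -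
  have "drop (a - 1) xs \<noteq> []" "last (drop (a - 1) xs) = last xs" using assms by auto
  then show ?thesis using assms
    by (auto simp: lollipop_word_def distinct_adj_append_iff)
qed

text \<open>Both graphs extend the disjoint union of a clique on the first \<open>a\<close>
  positions and a path on the others: position \<open>a\<close> is joined to the whole clique in one
  case, to position \<open>a - 1\<close> only in the other.\<close>

lemma lollipop_word_refine:
  assumes "1 \<le> a" "a < length xs"
  shows "lollipop_word (Suc a) xs \<longleftrightarrow>
      distinct (take a xs) \<and> distinct_adj (drop a xs) \<and> xs ! a \<notin> set (take a xs)"
    and "lollipop_word a xs \<longleftrightarrow>
      distinct (take a xs) \<and> distinct_adj (drop a xs) \<and> xs ! (a - 1) \<noteq> xs ! a"
proof -
  show "lollipop_word (Suc a) xs \<longleftrightarrow>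
      distinct (take a xs) \<and> distinct_adj (drop a xs) \<and> xs ! a \<notin> set (take a xs)"
    using assms by (auto simp: lollipop_word_def take_Suc_conv_app_nth)
  have "drop (a - 1) xs = xs ! (a - 1) # drop a xs"
    using Cons_nth_drop_Suc[of "a - 1" xs] assms by simp
  moreover have "hd (drop a xs) = xs ! a" "drop a xs \<noteq> []"
    using assms by (auto simp: hd_drop_conv_nth)
  ultimately show "lollipop_word a xs \<longleftrightarrow>
      distinct (take a xs) \<and> distinct_adj (drop a xs) \<and> xs ! (a - 1) \<noteq> xs ! a"
    by (auto simp: lollipop_word_def distinct_adj_Cons)
qed

text \<open>An identity between indicator functions, checked one word at a time, becomes an identity
  of series.\<close>

lemma words_gf_decompose:
  assumes "\<And>xs. length xs = N \<Longrightarrow>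
    (of_bool (p xs) :: 'a::comm_ring_1) = of_bool (q xs) + (\<Sum>i\<in>I. of_bool (r i xs))"
  shows "(words_gf N p :: 'a mfps) = words_gf N q + (\<Sum>i\<in>I. words_gf N (r i))"
proof -
  have "(of_bool (length xs = N \<and> 0 \<notin> set xs \<and> p xs) :: 'a) =
      of_bool (length xs = N \<and> 0 \<notin> set xs \<and> q xs) +
      (\<Sum>i\<in>I. of_bool (length xs = N \<and> 0 \<notin> set xs \<and> r i xs))" for xs
    using assms[of xs] by (cases "length xs = N \<and> 0 \<notin> set xs") auto
  then show ?thesis
    unfolding words_gf_def list_gf_sum[symmetric] list_gf_add[symmetric] by simp
qed

text \<open>Relating the first path vertex \<open>w\<close> to \<open>K\<^sub>a\<close>: in a coloring of \<open>K\<^sub>a \<union> P\<close> at most one vertex of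
  \<open>K\<^sub>a\<close> shares the color of \<open>w\<close>, and by symmetry each of them does so equally often.\<close>

lemma lollipop_gf_refine:
  assumes "1 \<le> a" "a < N"
  shows "of_nat a * lollipop_gf a N =
    lollipop_gf (Suc a) N
      + of_nat (a - 1) * (of_nat (fact a) * esym a * lollipop_gf 1 (N - a) :: 'a::comm_ring_1 mfps)"
proof -
  define p where "p = (\<lambda>xs :: nat list. distinct (take a xs) \<and> distinct_adj (drop a xs))"
  define V :: "nat \<Rightarrow> 'a mfps" where "V i = words_gf N (\<lambda>xs. p xs \<and> xs ! i = xs ! a)" for i
  have prod: "words_gf N p = of_nat (fact a) * esym a * (lollipop_gf 1 (N - a) :: 'a mfps)"
  proof -
    have "words_gf a distinct * words_gf (N - a) distinct_adj = (words_gf N p :: 'a mfps)"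
      using words_gf_mult[of a distinct "N - a" distinct_adj] assms by (simp add: p_def)
    then show ?thesis by (simp add: words_gf_distinct lollipop_gf_def del: of_nat_fact)
  qed
  \<comment> \<open>Swapping the clique positions \<open>i\<close> and \<open>a - 1\<close>
    preserves \<open>p\<close> and turns one coincidence with position \<open>a\<close> into the
    other.\<close>
  have eqV: "V i = V (a - 1)" if "i < a" for i
  proof -
    have "V (a - 1) = words_gf N (\<lambda>xs. (p (swap_at i (a - 1) xs)
        \<and> swap_at i (a - 1) xs ! (a - 1) = swap_at i (a - 1) xs ! a))"
      unfolding V_def by (rule words_gf_swap[symmetric])
    also have "\<dots> = V i"
      unfolding V_def
    proof (rule words_gf_cong)
      fix xs :: "nat list" assume len: "length xs = N"
      have "take a (swap_at i (a - 1) xs) = swap_at i (a - 1) (take a xs)"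
        using that assms len by (auto simp: swap_at_def take_update_swap)
      then have "distinct (take a (swap_at i (a - 1) xs)) = distinct (take a xs)"
        by (metis mset_swap_at mset_eq_imp_distinct_iff)
      moreover have "drop a (swap_at i (a - 1) xs) = drop a xs"
        using that assms len by (auto simp: swap_at_def)
      moreover have "swap_at i (a - 1) xs ! (a - 1) = xs ! i" "swap_at i (a - 1) xs ! a = xs ! a"
        using that assms len by (auto simp: swap_at_def nth_list_update)
      ultimately show "(p (swap_at i (a - 1) xs)
        \<and> swap_at i (a - 1) xs ! (a - 1) = swap_at i (a - 1) xs ! a) = (p xs \<and> xs ! i = xs ! a)"
        by (simp add: p_def)
    qed
    finally show ?thesis by simp
  qed
  have "words_gf N p = lollipop_gf a N + (\<Sum>i\<in>{a - 1}. V i)"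
    unfolding lollipop_gf_def V_def
    by (rule words_gf_decompose) (use assms in \<open>auto simp: lollipop_word_refine(2) p_def\<close>)
  then have one: "words_gf N p = lollipop_gf a N + V (a - 1)" by simp
  have "words_gf N p = lollipop_gf (Suc a) N + (\<Sum>i<a. V i)"
    unfolding lollipop_gf_def V_def
  proof (rule words_gf_decompose)
    fix xs :: "nat list" assume len: "length xs = N"
    show "(of_bool (p xs) :: 'a) = of_bool (lollipop_word (Suc a) xs) +
        (\<Sum>i<a. of_bool (p xs \<and> xs ! i = xs ! a))"
    proof (cases "p xs \<and> xs ! a \<in> set (take a xs)")
      case True
      then obtain j where j: "j < a" "xs ! j = xs ! a"
        using len assms by (auto simp: in_set_conv_nth)
      have "i = j" if "i < a" "xs ! i = xs ! a" for i
        using True that j len assms unfolding p_def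
        by (metis distinct_conv_nth length_take less_imp_le min.absorb2 nth_take)
      then have "(p xs \<and> xs ! i = xs ! a) = (i = j)" if "i < a" for i
        using True j that by blast
      then have "(\<Sum>i<a. of_bool (p xs \<and> xs ! i = xs ! a)) = (\<Sum>i<a. of_bool (i = j) :: 'a)"
        by (intro sum.cong refl) simp
      also have "\<dots> = 1" using j by (simp add: of_bool_def)
      finally show ?thesis
        using True len assms by (simp add: lollipop_word_refine)
    next
      case False
      have "xs ! i \<in> set (take a xs)" if "i < a" for i
        using that len assms by (auto simp: in_set_conv_nth)
      then have "(\<Sum>i<a. of_bool (p xs \<and> xs ! i = xs ! a)) = (0 :: 'a)"
        using False by (intro sum.neutral) (metis lessThan_iff of_bool_eq(1))
      then show ?thesis
        using False len assms by (auto simp: lollipop_word_refine p_def)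
    qed
  qed
  also have "(\<Sum>i<a. V i) = (\<Sum>i<a. V (a - 1))"
    by (intro sum.cong refl eqV) simp
  also have "\<dots> = of_nat a * V (a - 1)"
    by simp
  finally have all: "words_gf N p = lollipop_gf (Suc a) N + of_nat a * V (a - 1)" .
  \<comment> \<open>The unknown \<open>V (a - 1)\<close> is eliminated between \<open>one\<close>
    and \<open>all\<close>.\<close>
  have "lollipop_gf (Suc a) N + (of_nat a - 1) * words_gf N p
      = of_nat a * words_gf N p - of_nat a * V (a - 1)"
    using all by (simp add: eq_diff_eq[symmetric] left_diff_distrib)
  also have "\<dots> = of_nat a * lollipop_gf a N"
    unfolding one by (simp add: algebra_simps)
  finally show ?thesis
    using assms by (simp add: prod of_nat_diff)
qed

section \<open>Weighted sums over compositions with a large last part\<close>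

definition comp_tail :: "nat list \<Rightarrow> 'a::comm_ring_1 mfps" where
  "comp_tail R = (\<Prod>k\<leftarrow>R. of_nat (k - 1) * esym k)"

definition comp_term :: "nat list \<Rightarrow> 'a::comm_ring_1 mfps" where
  "comp_term K = of_nat (comp_weight K) * esym_comp K"

definition last_ge_comps :: "nat \<Rightarrow> nat \<Rightarrow> nat list set" where
  "last_ge_comps a N = {K. K \<Turnstile> N \<and> K \<noteq> [] \<and> a \<le> last K}"

definition lollipop_sum :: "nat \<Rightarrow> nat \<Rightarrow> 'a::comm_ring_1 mfps" where
  "lollipop_sum a N = (\<Sum>K\<in>last_ge_comps a N. comp_term K)"

lemma composition_Nil [simp]: "[] \<Turnstile> N \<longleftrightarrow> N = 0"
  by (auto simp: is_composition_def)

lemma composition_Cons: "k # K \<Turnstile> N \<longleftrightarrow> 1 \<le> k \<and> k \<le> N \<and> K \<Turnstile> N - k"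
  by (auto simp: is_composition_def)

lemma composition_sum_list: "K \<Turnstile> N \<Longrightarrow> sum_list K = N"
  by (simp add: is_composition_def)

lemma finite_last_ge_comps [simp]: "finite (last_ge_comps a N)"
  by (rule finite_subset[OF _ finite_compositions[of N]]) (auto simp: last_ge_comps_def)

lemma comp_tail_simps [simp]:
  "comp_tail [] = 1"
  "comp_tail (k # R) = of_nat (k - 1) * esym k * comp_tail R"
  "comp_tail (R @ R') = comp_tail R * comp_tail R'"
  by (simp_all add: comp_tail_def)

lemma comp_term_Cons: "comp_term (k # R) = of_nat k * esym k * (comp_tail R :: 'a::comm_ring_1 mfps)"
proof -
  have "comp_tail R = (of_nat (\<Prod>j\<leftarrow>R. j - 1) * esym_comp R :: 'a mfps)"
    by (induction R) (simp_all add: esym_comp_def ac_simps)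
  then show ?thesis by (simp add: comp_term_def comp_weight_def esym_comp_def ac_simps)
qed

lemma comp_term_append: "J \<noteq> [] \<Longrightarrow> comp_term (J @ R) = comp_term J * comp_tail R"
  by (cases J) (simp_all add: comp_term_Cons algebra_simps)

text \<open>The compositions lost on passing from \<open>a\<close> to \<open>Suc a\<close> are those
  ending in \<open>a\<close>; deleting that part removes the factor \<open>(a - 1) e_a\<close>. This
  is the recurrence of \<open>lollipop_gf_refine\<close> freed of factorials.\<close>

lemma lollipop_sum_refine:
  assumes "1 \<le> a" "a < N"
  shows "lollipop_sum a N =
    lollipop_sum (Suc a) N + of_nat (a - 1) * esym a * (lollipop_sum 1 (N - a) :: 'a::comm_ring_1 mfps)"
proof -
  have split: "last_ge_comps a N = last_ge_comps (Suc a) N \<union> (\<lambda>J. J @ [a]) ` last_ge_comps 1 (N - a)"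
  proof (intro equalityI subsetI)
    fix K assume K: "K \<in> last_ge_comps a N"
    show "K \<in> last_ge_comps (Suc a) N \<union> (\<lambda>J. J @ [a]) ` last_ge_comps 1 (N - a)"
    proof (cases "last K = a")
      case True
      with K have snoc: "K = butlast K @ [a]"
        by (auto simp: last_ge_comps_def)
      with K have "butlast K @ [a] \<Turnstile> N" by (simp add: last_ge_comps_def)
      then have "butlast K \<Turnstile> N - a" by (auto simp: is_composition_def)
      \<comment> \<open>Something must precede the final part, since a first part would carry the
        weight \<open>a\<close> and not \<open>a - 1\<close>.\<close>
      moreover from this assms have "butlast K \<noteq> []" by auto
      ultimately have "butlast K \<in> last_ge_comps 1 (N - a)"
        by (auto simp: last_ge_comps_def is_composition_def)
      with snoc show ?thesis by blast
    qed (use K in \<open>auto simp: last_ge_comps_def\<close>)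
  qed (use assms in \<open>auto simp: last_ge_comps_def is_composition_def\<close>)
  have "lollipop_sum a N = lollipop_sum (Suc a) N
      + (\<Sum>K\<in>(\<lambda>J. J @ [a]) ` last_ge_comps 1 (N - a). comp_term K :: 'a mfps)"
    unfolding lollipop_sum_def split
    by (rule sum.union_disjoint) (simp, simp, auto simp: last_ge_comps_def)
  also have "(\<Sum>K\<in>(\<lambda>J. J @ [a]) ` last_ge_comps 1 (N - a). comp_term K :: 'a mfps) =
      (\<Sum>J\<in>last_ge_comps 1 (N - a). comp_term J * (of_nat (a - 1) * esym a))"
    by (subst sum.reindex)
      (auto simp: inj_on_def comp_term_append last_ge_comps_def intro!: sum.cong)
  also have "\<dots> = of_nat (a - 1) * esym a * lollipop_sum 1 (N - a)"
    by (simp add: lollipop_sum_def sum_distrib_right[symmetric] mult.commute)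
  finally show ?thesis .
qed

lemma lollipop_sum_self:
  assumes "1 \<le> N"
  shows "lollipop_sum N N = of_nat N * esym N"
proof -
  have "last_ge_comps N N = {[N]}"
  proof (intro equalityI subsetI)
    fix K assume K: "K \<in> last_ge_comps N N"
    then have "K = butlast K @ [last K]" by (auto simp: last_ge_comps_def)
    moreover from this K have "sum_list (butlast K) + last K = N"
      by (metis (no_types, lifting) composition_sum_list last_ge_comps_def mem_Collect_eq
          sum_list.Cons sum_list.Nil sum_list_append add.right_neutral)
    moreover have "\<forall>k\<in>set (butlast K). 1 \<le> k"
      using K by (auto simp: last_ge_comps_def is_composition_def dest: in_set_butlastD)
    moreover have "N \<le> last K" using K by (simp add: last_ge_comps_def)
    ultimately show "K \<in> {[N]}"
      by (cases "butlast K") auto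
  qed (use assms in \<open>auto simp: last_ge_comps_def is_composition_def\<close>)
  then show ?thesis by (simp add: lollipop_sum_def comp_term_Cons)
qed

lemma of_nat_mult_mfps_cancel:
  fixes f g :: "'a::{comm_ring_1, semiring_char_0, idom} mfps"
  assumes "of_nat c * f = of_nat c * g" "c \<noteq> 0"
  shows "f = g"
proof (rule mfps_eqI)
  fix m
  have "mcoeff (of_nat c * f) m = mcoeff (of_nat c * g) m" by (simp only: assms)
  then show "mcoeff f m = mcoeff g m" using assms(2) by (simp add: mcoeff_of_nat_mult)
qed

lemma lollipop_gf_self: "1 \<le> N \<Longrightarrow> lollipop_gf N N = of_nat (fact N) * esym N"
proof -
  assume N: "1 \<le> N"
  have "distinct_adj (drop (N - 1) xs)" if "length xs = N" for xs :: "nat list"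
  proof -
    have "length (drop (N - 1) xs) = 1" using that N by simp
    then show ?thesis by (metis distinct_adj_Cons length_0_conv length_Suc_conv One_nat_def)
  qed
  then have "lollipop_gf N N = words_gf N distinct"
    unfolding lollipop_gf_def by (intro words_gf_cong) (simp add: lollipop_word_def)
  then show ?thesis by (simp only: words_gf_distinct)
qed

text \<open>Both sides satisfy the same recurrence in \<open>a\<close>, which descends from the
  complete graph at \<open>a = N\<close> and involves a path on fewer vertices. Hence an outer
  induction on \<open>N\<close> and an inner downward induction on \<open>a\<close>.\<close>

lemma lollipop_gf_eq_sum:
  assumes "1 \<le> a" "a \<le> N"
  shows "lollipop_gf a N =
    of_nat (fact (a - 1)) * (lollipop_sum a N :: 'a::{comm_ring_1, semiring_char_0, idom} mfps)"
  using assms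
proof (induction N arbitrary: a rule: less_induct)
  case (less N)
  from less.prems(2,1) show ?case
  proof (induction rule: inc_induct)
    case base
    have "fact N = N * fact (N - 1)" using base by (simp add: fact_reduce)
    then show ?case using base
      by (simp add: lollipop_gf_self lollipop_sum_self algebra_simps del: of_nat_fact)
  next
    case (step b)
    have f: "fact b = b * fact (b - 1)" using step by (simp add: fact_reduce)
    have P: "lollipop_gf 1 (N - b) = (lollipop_sum 1 (N - b) :: 'a mfps)"
      using less.IH[of "N - b" 1] step by simp
    have "of_nat b * lollipop_gf b N =
        lollipop_gf (Suc b) N + of_nat (b - 1) * (of_nat (fact b) * esym b * lollipop_gf 1 (N - b) :: 'a mfps)"
      using step by (intro lollipop_gf_refine) auto
    also have "\<dots> = of_nat (fact b) * (lollipop_sum (Suc b) N +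
        of_nat (b - 1) * esym b * lollipop_sum 1 (N - b))"
      unfolding P using step by (simp add: algebra_simps del: of_nat_fact)
    also have "\<dots> = of_nat (fact b) * lollipop_sum b N"
      using lollipop_sum_refine[of b N, where 'a='a] step by simp
    also have "\<dots> = of_nat b * (of_nat (fact (b - 1)) * lollipop_sum b N)"
      unfolding f by (simp add: mult.assoc del: of_nat_fact)
    \<comment> \<open>The recurrence only yields \<open>b\<close> times the series; characteristic 0
      allows the cancellation.\<close>
    finally show ?case by (rule of_nat_mult_mfps_cancel) (use step in simp)
  qed
qed

section \<open>Cutting a composition at the crossing part\<close>

text \<open>The hypotheses say that the parts of \<open>J\<close> before the last sum to less than
  \<open>c\<close>, so \<open>J\<close> ends with the first part that reaches
  \<open>c\<close>.\<close>

lemma comp_sigma_append: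
  assumes "J \<noteq> []" "c \<le> sum_list J" "sum_list J < c + last J"
  shows "comp_sigma (J @ R) c = sum_list J"
  unfolding comp_sigma_def
proof (rule Min_eqI)
  have "{s. \<exists>j\<le>length (J @ R). s = sum_list (take j (J @ R)) \<and> c \<le> s}
      \<subseteq> (\<lambda>j. sum_list (take j (J @ R))) ` {..length (J @ R)}" by auto
  then show "finite {s. \<exists>j\<le>length (J @ R). s = sum_list (take j (J @ R)) \<and> c \<le> s}"
    by (rule finite_subset) simp
  show "sum_list J \<in> {s. \<exists>j\<le>length (J @ R). s = sum_list (take j (J @ R)) \<and> c \<le> s}"
    using assms by (auto intro!: exI[of _ "length J"])
  fix s assume "s \<in> {s. \<exists>j\<le>length (J @ R). s = sum_list (take j (J @ R)) \<and> c \<le> s}"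
  then obtain j where j: "s = sum_list (take j (J @ R))" "c \<le> s" by auto
  show "sum_list J \<le> s"
  proof (cases "length J \<le> j")
    case True
    then show ?thesis by (simp add: j)
  next
    case False
    have J: "J = butlast J @ [last J]" using assms by simp
    have "take j (J @ R) = take j (butlast J)"
      using False by (subst J) simp
    moreover have "sum_list (take j (butlast J)) \<le> sum_list (butlast J)"
      by (metis append_take_drop_id le_add1 sum_list_append)
    moreover have "sum_list (butlast J) + last J = sum_list J"
      by (subst (3) J) (simp only: sum_list_append sum_list.Cons sum_list.Nil add_0_right)
    ultimately show ?thesis using j assms by simp
  qed
qed

text \<open>A last part exceeding \<open>t\<close> means that the sum before it stays below
  \<open>h\<close>. Thus \<open>last_ge_comps (Suc t) (h + t)\<close> consists of the prefixes whose
  last part crosses \<open>h\<close> and overshoots it by exactly \<open>t\<close>.\<close>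

lemma comp_theta_append:
  assumes "J \<in> last_ge_comps (Suc t) (h + t)"
  shows "comp_theta (J @ R) h = t"
proof -
  have "J \<noteq> []" "sum_list J = h + t" "t < last J"
    using assms by (auto simp: last_ge_comps_def is_composition_def)
  then show ?thesis by (simp add: comp_theta_def comp_sigma_append)
qed

lemma comp_crossing_exists:
  assumes "1 \<le> h" "h \<le> N" "K \<Turnstile> N"
  obtains J R where "K = J @ R" "J \<in> last_ge_comps (Suc (comp_theta K h)) (h + comp_theta K h)"
proof -
  define j where "j = (LEAST j. h \<le> sum_list (take j K))"
  have ex: "h \<le> sum_list (take (length K) K)"
    using assms by (simp add: is_composition_def)
  then have j: "h \<le> sum_list (take j K)" and len: "j \<le> length K"
    unfolding j_def by (rule LeastI, rule Least_le)
  \<comment> \<open>The bound \<open>1 \<le> h\<close> rules out the empty prefix, so there is a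
    crossing part.\<close>
  have "j \<noteq> 0" using j assms by (auto intro: gr0I)
  then have less: "sum_list (take (j - 1) K) < h"
    using not_less_Least[of "j - 1" "\<lambda>j. h \<le> sum_list (take j K)"] by (simp add: j_def not_le)
  have T: "take j K = take (j - 1) K @ [K ! (j - 1)]"
    using \<open>j \<noteq> 0\<close> len take_Suc_conv_app_nth[of "j - 1" K] by simp
  have ne: "take j K \<noteq> []" and last: "last (take j K) = K ! (j - 1)"
    by (simp_all add: T)
  have sum: "sum_list (take j K) = sum_list (take (j - 1) K) + last (take j K)"
    by (simp add: last) (simp add: T)
  have "comp_sigma (take j K @ drop j K) h = sum_list (take j K)"
    using ne j less sum by (intro comp_sigma_append) auto
  then have \<theta>: "sum_list (take j K) = h + comp_theta K h"
    using j by (simp add: comp_theta_def)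
  show ?thesis
  proof (rule that)
    show "K = take j K @ drop j K" by simp
    show "take j K \<in> last_ge_comps (Suc (comp_theta K h)) (h + comp_theta K h)"
      using assms(3) ne \<theta> sum less
      by (auto simp: last_ge_comps_def is_composition_def dest: in_set_takeD)
  qed
qed

lemma composition_append_self:
  assumes "J @ R \<Turnstile> N" "J \<Turnstile> N"
  shows "R = []"
  using assms by (cases R) (auto simp: is_composition_def)

text \<open>Of two prefixes of one list, one extends the other; since parts are positive, equal sums
  leave no room for an extension.\<close>

lemma composition_append_cancel:
  assumes "J @ R = J' @ R'" "J \<Turnstile> N" "J' \<Turnstile> N"
  shows "J = J' \<and> R = R'"
proof -
  from assms(1) obtain us where "J = J' @ us \<and> us @ R = R' \<or> J @ us = J' \<and> R = us @ R'"
    unfolding append_eq_append_conv2 by blast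
  moreover from this have "us = []"
    using assms(2,3) composition_append_self by blast
  ultimately show ?thesis by auto
qed

text \<open>Existence and uniqueness of the crossing prefix make concatenation a bijection from the
  pairs \<open>(J, R)\<close>. The predicate \<open>P\<close> carries whatever further conditions a
  particular sum imposes.\<close>

lemma comp_crossing_sum:
  assumes "1 \<le> h" "h + t \<le> N"
  shows "(\<Sum>K | K \<Turnstile> N \<and> comp_theta K h = t \<and> P K. f K) =
    (\<Sum>J\<in>last_ge_comps (Suc t) (h + t). \<Sum>R | R \<Turnstile> N - h - t \<and> P (J @ R). f (J @ R))"
proof -
  let ?A = "last_ge_comps (Suc t) (h + t)"
  let ?B = "\<lambda>J. {R. R \<Turnstile> N - h - t \<and> P (J @ R)}"
  have "finite (?B J)" for J
    by (rule finite_subset[OF _ finite_compositions]) auto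
  then have "(\<Sum>J\<in>?A. \<Sum>R\<in>?B J. f (J @ R)) = (\<Sum>(J, R)\<in>(SIGMA J:?A. ?B J). f (J @ R))"
    by (intro sum.Sigma) auto
  also have "\<dots> = (\<Sum>K\<in>(\<lambda>(J, R). J @ R) ` (SIGMA J:?A. ?B J). f K)"
  proof (subst sum.reindex)
    show "inj_on (\<lambda>(J, R). J @ R) (SIGMA J:?A. ?B J)"
    proof (rule inj_onI, clarsimp)
      fix J R J' R'
      assume "J \<in> ?A" "J' \<in> ?A" "J @ R = J' @ R'"
      then show "J = J' \<and> R = R'"
        by (intro composition_append_cancel) (auto simp: last_ge_comps_def)
    qed
  qed (simp add: case_prod_unfold)
  also have "(\<lambda>(J, R). J @ R) ` (SIGMA J:?A. ?B J) = {K. K \<Turnstile> N \<and> comp_theta K h = t \<and> P K}"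
  proof (intro equalityI subsetI)
    fix K assume "K \<in> (\<lambda>(J, R). J @ R) ` (SIGMA J:?A. ?B J)"
    then obtain J R where K: "K = J @ R" "J \<in> ?A" "R \<in> ?B J" by auto
    then have "K \<Turnstile> N" using assms by (auto simp: last_ge_comps_def is_composition_def)
    with K show "K \<in> {K. K \<Turnstile> N \<and> comp_theta K h = t \<and> P K}"
      by (simp add: comp_theta_append)
  next
    fix K assume "K \<in> {K. K \<Turnstile> N \<and> comp_theta K h = t \<and> P K}"
    then have K: "K \<Turnstile> N" "comp_theta K h = t" "P K" by auto
    moreover have "h \<le> N" using assms by simp
    ultimately obtain J R where JR: "K = J @ R" "J \<in> ?A"
      using comp_crossing_exists[of h N K] assms(1) by metis
    moreover have "R \<in> ?B J"
      using K JR by (auto simp: last_ge_comps_def is_composition_def)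
    ultimately show "K \<in> (\<lambda>(J, R). J @ R) ` (SIGMA J:?A. ?B J)" by force
  qed
  finally show ?thesis by simp
qed

text \<open>The part 1 in front makes the empty tail admissible exactly when \<open>a \<le> 1\<close>.\<close>

definition tail_sum :: "nat \<Rightarrow> nat \<Rightarrow> 'a::comm_ring_1 mfps" where
  "tail_sum a N = (\<Sum>R | R \<Turnstile> N \<and> a \<le> last (1 # R). comp_tail R)"

text \<open>The first part \<open>r\<close> has the reduced weight \<open>r - 2\<close>. Truncation
  gives 0 and not -1 at \<open>r = 1\<close>, which is the source of the \<open>esym 1\<close> term
  in \<open>reduced_sum_eq\<close>.\<close>

definition reduced_sum :: "nat \<Rightarrow> nat \<Rightarrow> 'a::comm_ring_1 mfps" where
  "reduced_sum a N =
     (\<Sum>R\<in>last_ge_comps a N. of_nat (hd R - 2) * esym (hd R) * comp_tail (tl R))"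

lemma reduced_sum_hd_ge_3:
  "reduced_sum a N = (\<Sum>R | R \<in> last_ge_comps a N \<and> 3 \<le> hd R.
     of_nat (hd R - 2) * esym (hd R) * comp_tail (tl R))"
  unfolding reduced_sum_def
proof (rule sum.mono_neutral_right)
  show "\<forall>R\<in>last_ge_comps a N - {R. R \<in> last_ge_comps a N \<and> 3 \<le> hd R}.
      of_nat (hd R - 2) * esym (hd R) * comp_tail (tl R) = 0"
  proof
    fix R assume "R \<in> last_ge_comps a N - {R. R \<in> last_ge_comps a N \<and> 3 \<le> hd R}"
    then have "hd R - 2 = 0" by auto
    then show "of_nat (hd R - 2) * esym (hd R) * comp_tail (tl R) = 0" by (simp only:) simp
  qed
qed auto

text \<open>The coefficients attached to the first part \<open>k\<close> satisfy
  \<open>(k - 2) + k = 2 (k - 1)\<close> for \<open>k \<ge> 2\<close>, while for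
  \<open>k = 1\<close> truncation leaves an excess of 1. Stripping that part 1 gives tails of sum
  \<open>N - 1\<close>.\<close>

lemma reduced_sum_eq:
  assumes "1 \<le> N"
  shows "reduced_sum a N + lollipop_sum a N =
    2 * tail_sum a N + esym 1 * (tail_sum a (N - 1) :: 'a::comm_ring_1 mfps)"
proof -
  have comps: "{R. R \<Turnstile> N \<and> a \<le> last (1 # R)} = last_ge_comps a N"
    using assms by (auto simp: last_ge_comps_def)
  \<comment> \<open>The stripped part is the 1 put in front in \<open>tail_sum\<close>, so the
    conditions on the last part agree even if nothing remains.\<close>
  have "{R \<in> last_ge_comps a N. hd R = 1} = (#) 1 ` {R. R \<Turnstile> N - 1 \<and> a \<le> last (1 # R)}"
  proof (intro equalityI subsetI)
    fix R assume "R \<in> {R \<in> last_ge_comps a N. hd R = 1}"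
    then show "R \<in> (#) 1 ` {R. R \<Turnstile> N - 1 \<and> a \<le> last (1 # R)}"
      by (cases R) (auto simp: last_ge_comps_def composition_Cons)
  qed (use assms in \<open>auto simp: last_ge_comps_def composition_Cons\<close>)
  then have "(\<Sum>R | R \<in> last_ge_comps a N \<and> hd R = 1. esym 1 * comp_tail (tl R)) =
      esym 1 * (tail_sum a (N - 1) :: 'a mfps)"
    by (simp add: sum.reindex tail_sum_def sum_distrib_left)
  then have one: "esym 1 * (tail_sum a (N - 1) :: 'a mfps) =
      (\<Sum>R\<in>last_ge_comps a N. if hd R = 1 then esym 1 * comp_tail (tl R) else 0)"
    by (simp add: sum.inter_filter cong: if_cong)
  have "of_nat (hd R - 2) * esym (hd R) * comp_tail (tl R) + comp_term R =
      2 * comp_tail R + ((if hd R = 1 then esym 1 * comp_tail (tl R) else 0) :: 'a mfps)"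
    if R: "R \<in> last_ge_comps a N" for R
  proof -
    obtain k R' where k: "R = k # R'" "1 \<le> k"
      using R by (cases R) (auto simp: last_ge_comps_def composition_Cons)
    have "(of_nat (k - 2) + of_nat k :: 'a mfps) = 2 * of_nat (k - 1) + (if k = 1 then 1 else 0)"
      using k(2) by (cases "k = 1") (simp_all add: of_nat_diff)
    then have "(of_nat (k - 2) + of_nat k) * (esym k * comp_tail R' :: 'a mfps) =
        (2 * of_nat (k - 1) + (if k = 1 then 1 else 0)) * (esym k * comp_tail R')" by simp
    then show ?thesis by (simp add: k(1) comp_term_Cons algebra_simps split: if_splits)
  qed
  then have "(\<Sum>R\<in>last_ge_comps a N. of_nat (hd R - 2) * esym (hd R) * comp_tail (tl R) + comp_term R) =
      (\<Sum>R\<in>last_ge_comps a N. 2 * comp_tail R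
        + ((if hd R = 1 then esym 1 * comp_tail (tl R) else 0) :: 'a mfps))"
    by (intro sum.cong refl)
  moreover have "tail_sum a N = (\<Sum>R\<in>last_ge_comps a N. comp_tail R :: 'a mfps)"
    unfolding tail_sum_def comps ..
  ultimately show ?thesis
    unfolding one by (simp add: reduced_sum_def lollipop_sum_def sum.distrib sum_distrib_left)
qed

text \<open>Compositions are sorted by overshoot, and those with overshoot at most 2 are cut after
  the crossing part. The hypothesis on \<open>N = h + 2\<close> concerns the empty tail: the last
  part then lies in the prefix, but \<open>tail_sum\<close> sees only the value 1.\<close>

lemma lollipop_sum_split:
  assumes "1 \<le> h" "h + 2 \<le> N" "N = h + 2 \<longrightarrow> a \<le> 1"
  shows "lollipop_sum a N = (\<Sum>K | K \<in> last_ge_comps a N \<and> 3 \<le> comp_theta K h. comp_term K)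
    + lollipop_sum 1 h * tail_sum a (N - h)
    + lollipop_sum 2 (h + 1) * tail_sum a (N - h - 1)
    + lollipop_sum 3 (h + 2) * (tail_sum a (N - h - 2) :: 'a::comm_ring_1 mfps)"
proof -
  have part: "(\<Sum>K | K \<in> last_ge_comps a N \<and> comp_theta K h = t. comp_term K) =
      lollipop_sum (Suc t) (h + t) * (tail_sum a (N - h - t) :: 'a mfps)" if "t \<le> 2" for t
  proof -
    have "{K. K \<in> last_ge_comps a N \<and> comp_theta K h = t} =
        {K. K \<Turnstile> N \<and> comp_theta K h = t \<and> (K \<noteq> [] \<and> a \<le> last K)}"
      by (auto simp: last_ge_comps_def)
    then have "(\<Sum>K | K \<in> last_ge_comps a N \<and> comp_theta K h = t. comp_term K :: 'a mfps) =
        (\<Sum>K | K \<Turnstile> N \<and> comp_theta K h = t \<and> (K \<noteq> [] \<and> a \<le> last K). comp_term K)"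
      by (rule arg_cong)
    also have "\<dots> = (\<Sum>J\<in>last_ge_comps (Suc t) (h + t).
        \<Sum>R | R \<Turnstile> N - h - t \<and> (J @ R \<noteq> [] \<and> a \<le> last (J @ R)). comp_term (J @ R))"
      using that assms by (intro comp_crossing_sum) auto
    also have "\<dots> = (\<Sum>J\<in>last_ge_comps (Suc t) (h + t). comp_term J * tail_sum a (N - h - t))"
    proof (rule sum.cong[OF refl])
      fix J assume J: "J \<in> last_ge_comps (Suc t) (h + t)"
      then have ne: "J \<noteq> []" "1 \<le> last J" by (auto simp: last_ge_comps_def)
      \<comment> \<open>An empty tail occurs only for \<open>t = 2\<close> and
        \<open>N = h + 2\<close>.\<close>
      have "a \<le> 1" if "[] \<Turnstile> N - h - t" using that \<open>t \<le> 2\<close> assms by auto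
      then have "{R. R \<Turnstile> N - h - t \<and> (J @ R \<noteq> [] \<and> a \<le> last (J @ R))} =
          {R. R \<Turnstile> N - h - t \<and> a \<le> last (1 # R)}"
        using ne by (fastforce simp: last_append split: if_splits)
      then show "(\<Sum>R | R \<Turnstile> N - h - t \<and> (J @ R \<noteq> [] \<and> a \<le> last (J @ R)). comp_term (J @ R)) =
          comp_term J * (tail_sum a (N - h - t) :: 'a mfps)"
        using ne(1) by (simp add: comp_term_append tail_sum_def sum_distrib_left del: last.simps)
    qed
    finally show ?thesis by (simp add: lollipop_sum_def sum_distrib_right)
  qed
  have cong: "(\<Sum>K | K \<in> last_ge_comps a N \<and> P K. comp_term K :: 'a mfps) =
      (\<Sum>K\<in>last_ge_comps a N. if P K then comp_term K else 0)" for P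
    by (simp add: sum.inter_filter)
  have "lollipop_sum a N = (\<Sum>K | K \<in> last_ge_comps a N \<and> 3 \<le> comp_theta K h. comp_term K)
    + (\<Sum>K | K \<in> last_ge_comps a N \<and> comp_theta K h = 0. comp_term K)
    + (\<Sum>K | K \<in> last_ge_comps a N \<and> comp_theta K h = 1. comp_term K)
    + (\<Sum>K | K \<in> last_ge_comps a N \<and> comp_theta K h = 2. comp_term K :: 'a mfps)"
    unfolding cong lollipop_sum_def sum.distrib[symmetric] by (intro sum.cong) auto
  then show ?thesis
    using part[of 0] part[of 1] part[of 2] by (simp add: numeral_eq_Suc)
qed

section \<open>Matching the third and fourth sums with reduced tails\<close>

lemma part_end_snoc: "part_end (K @ [r]) (Suc 0) = r" "K \<noteq> [] \<Longrightarrow> part_end (K @ [r]) 2 = last K"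
  by (auto simp: part_end_def nth_append last_conv_nth)

lemma part_end_last: "K \<noteq> [] \<Longrightarrow> part_end K 1 = last K"
  by (simp add: part_end_def last_conv_nth)

text \<open>A tail \<open>r # R\<close> is matched with \<open>R @ [r]\<close>, so the part of
  weight \<open>r - 2\<close> becomes the last part of the composition. The first alternative on the
  two final parts singles out the one-part tails; for longer tails
  \<open>a \<le> part_end K 2\<close> is the condition on the last part of
  \<open>r # R\<close>.\<close>

lemma third_sum_part:
  assumes "1 \<le> h" "h + a + 2 \<le> N" "t \<le> 1"
  shows "(\<Sum>K | K \<Turnstile> N \<and> comp_theta K h = t \<and> (2 \<le> length K \<and> 3 \<le> part_end K 1
      \<and> (N - h + 1 \<le> part_end K 1 + part_end K 2 \<or> a \<le> part_end K 2)).
        of_nat ((part_end K 1 - 2) * comp_weight (butlast K)) * esym_comp K) =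
    lollipop_sum (Suc t) (h + t) * (reduced_sum a (N - h - t) :: 'a::comm_ring_1 mfps)"
    (is "(\<Sum>K | _ \<and> _ \<and> ?P K. ?f K) = _")
proof -
  let ?M = "N - h - t"
  have "(\<Sum>K | K \<Turnstile> N \<and> comp_theta K h = t \<and> ?P K. ?f K) =
      (\<Sum>J\<in>last_ge_comps (Suc t) (h + t). \<Sum>S | S \<Turnstile> ?M \<and> ?P (J @ S). ?f (J @ S))"
    using assms by (intro comp_crossing_sum) auto
  also have "\<dots> = (\<Sum>J\<in>last_ge_comps (Suc t) (h + t). comp_term J * reduced_sum a ?M)"
  proof (rule sum.cong[OF refl])
    fix J assume J: "J \<in> last_ge_comps (Suc t) (h + t)"
    then have ne: "J \<noteq> []" and t: "t < last J" by (auto simp: last_ge_comps_def)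
    have set: "{S. S \<Turnstile> ?M \<and> ?P (J @ S)} = rotate1 ` {R \<in> last_ge_comps a ?M. 3 \<le> hd R}"
    proof (intro equalityI subsetI)
      fix S assume "S \<in> {S. S \<Turnstile> ?M \<and> ?P (J @ S)}"
      then have S: "S \<Turnstile> ?M" and P: "?P (J @ S)" by auto
      from S assms have "S \<noteq> []" by auto
      then obtain R r where Rr: "S = R @ [r]" by (metis append_butlast_last_id)
      from P have r: "3 \<le> r" by (simp add: Rr part_end_snoc flip: append_assoc)
      from S have R: "r # R \<Turnstile> ?M" by (auto simp: Rr is_composition_def)
      have "a \<le> last (r # R)"
      proof (cases "R = []")
        case True
        \<comment> \<open>A one-part tail equals \<open>N - h - t\<close>, which is at least
          \<open>a\<close> by the bound on \<open>N\<close>.\<close>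
        then show ?thesis using R assms by (auto simp: is_composition_def)
      next
        case False
        then have "last R \<le> sum_list R" by (simp add: member_le_sum_list)
        \<comment> \<open>The two final parts are thus too small for the first alternative.\<close>
        then have "r + last R \<le> ?M" using R by (auto simp: is_composition_def)
        moreover have "part_end (J @ S) 1 = r" "part_end (J @ S) 2 = last R"
          using False by (simp_all add: Rr part_end_snoc flip: append_assoc)
        ultimately show ?thesis using P False by auto
      qed
      with R r have "r # R \<in> {R \<in> last_ge_comps a ?M. 3 \<le> hd R}"
        by (auto simp: last_ge_comps_def)
      then show "S \<in> rotate1 ` {R \<in> last_ge_comps a ?M. 3 \<le> hd R}"
        by (force simp: Rr)
    next
      fix S assume "S \<in> rotate1 ` {R \<in> last_ge_comps a ?M. 3 \<le> hd R}"
      then obtain R' where R': "S = rotate1 R'" "R' \<in> last_ge_comps a ?M" "3 \<le> hd R'" by auto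
      then obtain r R where Rr: "R' = r # R" by (cases R') (auto simp: last_ge_comps_def)
      have S: "S = R @ [r]" by (simp add: R' Rr)
      have r: "3 \<le> r" and R: "r # R \<Turnstile> ?M" "a \<le> last (r # R)"
        using R' by (auto simp: Rr last_ge_comps_def)
      have p1: "part_end (J @ S) 1 = r" by (simp add: S part_end_snoc flip: append_assoc)
      have p2: "part_end (J @ S) 2 = last (J @ R)"
        using ne by (simp add: S part_end_snoc flip: append_assoc)
      have "N - h + 1 \<le> part_end (J @ S) 1 + part_end (J @ S) 2 \<or> a \<le> part_end (J @ S) 2"
      proof (cases "R = []")
        case True
        \<comment> \<open>The two final parts are \<open>last J\<close> and
          \<open>r = N - h - t\<close>; as \<open>last J\<close> exceeds \<open>t\<close>, their sum
          is at least \<open>N - h + 1\<close>.\<close>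
        then show ?thesis using p1 p2 t R by (auto simp: is_composition_def)
      next
        case False
        then show ?thesis using p2 R by simp
      qed
      moreover have "S \<Turnstile> ?M" using R by (auto simp: S is_composition_def)
      moreover have "2 \<le> length (J @ S)" using ne by (cases J) (auto simp: S)
      ultimately show "S \<in> {S. S \<Turnstile> ?M \<and> ?P (J @ S)}" using p1 r by auto
    qed
    have inj: "inj_on rotate1 A" for A :: "nat list set"
      using inj_rotate1 by (rule inj_on_subset) simp
    have "(\<Sum>S | S \<Turnstile> ?M \<and> ?P (J @ S). ?f (J @ S)) =
        (\<Sum>R | R \<in> last_ge_comps a ?M \<and> 3 \<le> hd R. ?f (J @ rotate1 R))"
      unfolding set by (subst sum.reindex[OF inj]) simp
    also have "\<dots> = (\<Sum>R | R \<in> last_ge_comps a ?M \<and> 3 \<le> hd R.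
        comp_term J * (of_nat (hd R - 2) * esym (hd R) * comp_tail (tl R)))"
    proof (rule sum.cong[OF refl])
      fix R assume "R \<in> {R \<in> last_ge_comps a ?M. 3 \<le> hd R}"
      then obtain r R' where R: "R = r # R'" by (cases R) (auto simp: last_ge_comps_def)
      have K: "J @ rotate1 R = (J @ R') @ [r]" by (simp add: R)
      have "?f (J @ rotate1 R) = of_nat (r - 2) * esym r * (comp_term (J @ R') :: 'a mfps)"
        unfolding K part_end_snoc(1)[of "J @ R'", folded One_nat_def] butlast_snoc
        by (simp add: comp_term_def esym_comp_def ac_simps)
      then show "?f (J @ rotate1 R) =
          comp_term J * (of_nat (hd R - 2) * esym (hd R) * comp_tail (tl R))"
        using ne by (simp add: R comp_term_append ac_simps)
    qed
    finally show "(\<Sum>S | S \<Turnstile> ?M \<and> ?P (J @ S). ?f (J @ S)) = comp_term J * (reduced_sum a ?M :: 'a mfps)"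
      by (simp add: reduced_sum_hd_ge_3 sum_distrib_left)
  qed
  finally show ?thesis by (simp add: lollipop_sum_def sum_distrib_right)
qed

lemma smult_mult_of_nat: "(x * of_nat c) \<odot> f = x \<odot> (of_nat c * f)"
  by (rule mfps_eqI) (simp add: mfps_smult.rep_eq mcoeff_of_nat_mult mult.assoc)

text \<open>Overshoot 2 places the end of \<open>J\<close> at \<open>h + 2\<close>, so the first
  part \<open>r\<close> of the tail crosses \<open>h + 3\<close> with overshoot
  \<open>r - 1\<close>. The fraction \<open>(r - 2) / (r - 1)\<close> then turns the tail weight
  \<open>r - 1\<close> into \<open>r - 2\<close>, and \<open>2 \<le> r - 1\<close> is the cutoff
  \<open>3 \<le> hd R\<close>.\<close>

lemma fourth_sum:
  assumes "1 \<le> h" "h + a + 2 \<le> N" "1 \<le> a"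
  shows "(\<Sum>K | K \<Turnstile> N \<and> comp_theta K h = 2 \<and> (K \<noteq> [] \<and> a \<le> last K \<and> 2 \<le> comp_theta K (h + 3)).
      ((of_nat (comp_theta K (h + 3)) - 1) / of_nat (comp_theta K (h + 3))
        * of_nat (comp_weight K)) \<odot> esym_comp K) =
    lollipop_sum 3 (h + 2) * (reduced_sum a (N - h - 2) :: 'a::field_char_0 mfps)"
    (is "(\<Sum>K | _ \<and> _ \<and> ?P K. ?f K) = _")
proof -
  let ?M = "N - h - 2"
  have "(\<Sum>K | K \<Turnstile> N \<and> comp_theta K h = 2 \<and> ?P K. ?f K) =
      (\<Sum>J\<in>last_ge_comps (Suc 2) (h + 2). \<Sum>R | R \<Turnstile> ?M \<and> ?P (J @ R). ?f (J @ R))"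
    using assms by (intro comp_crossing_sum) auto
  also have "\<dots> = (\<Sum>J\<in>last_ge_comps 3 (h + 2). comp_term J * reduced_sum a ?M)"
  proof (rule sum.cong)
    fix J assume J: "J \<in> last_ge_comps 3 (h + 2)"
    then have ne: "J \<noteq> []" by (auto simp: last_ge_comps_def)
    have \<theta>: "comp_theta (J @ r # R) (h + 3) = r - 1" if "1 \<le> r" for r R
    proof -
      have "J @ [r] \<in> last_ge_comps (Suc (r - 1)) (h + 3 + (r - 1))"
        using J that by (auto simp: last_ge_comps_def is_composition_def)
      from comp_theta_append[OF this, of R] show ?thesis by simp
    qed
    have set: "{R. R \<Turnstile> ?M \<and> ?P (J @ R)} = {R \<in> last_ge_comps a ?M. 3 \<le> hd R}"
    proof (intro Collect_cong)
      fix R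
      show "(R \<Turnstile> ?M \<and> ?P (J @ R)) = (R \<in> last_ge_comps a ?M \<and> 3 \<le> hd R)"
        \<comment> \<open>The tail is nonempty because its sum is at least \<open>a\<close>, hence
          positive; so the last part of \<open>J @ R\<close> is that of \<open>R\<close>.\<close>
        using assms \<theta> by (cases R) (auto simp: last_ge_comps_def composition_Cons)
    qed
    have "(\<Sum>R | R \<Turnstile> ?M \<and> ?P (J @ R). ?f (J @ R)) =
        (\<Sum>R | R \<in> last_ge_comps a ?M \<and> 3 \<le> hd R.
          comp_term J * (of_nat (hd R - 2) * esym (hd R) * comp_tail (tl R)))"
      unfolding set
    proof (rule sum.cong[OF refl])
      fix R assume R: "R \<in> {R \<in> last_ge_comps a ?M. 3 \<le> hd R}"
      then obtain r R' where rR: "R = r # R'" "3 \<le> r" by (cases R) (auto simp: last_ge_comps_def)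
      have "?f (J @ R) = ((of_nat (r - 1) - 1) / of_nat (r - 1)) \<odot> (comp_term (J @ R) :: 'a mfps)"
      proof -
        have "comp_theta (J @ R) (h + 3) = r - 1" using rR by (simp add: \<theta>)
        then show ?thesis by (simp only: smult_mult_of_nat comp_term_def)
      qed
      also have "\<dots> = ((of_nat (r - 1) - 1) / of_nat (r - 1)) \<odot>
          (of_nat (r - 1) * (comp_term J * (esym r * comp_tail R')))"
        using ne by (simp add: rR comp_term_append ac_simps)
      also have "\<dots> = ((of_nat (r - 1) - 1) / of_nat (r - 1) * of_nat (r - 1)) \<odot>
          (comp_term J * (esym r * comp_tail R'))"
        by (simp only: smult_mult_of_nat)
      also have "(of_nat (r - 1) - 1) / of_nat (r - 1) * of_nat (r - 1) = (of_nat (r - 2) :: 'a)"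
        using rR(2) by (simp add: of_nat_diff)
      finally show "?f (J @ R) =
          comp_term J * (of_nat (hd R - 2) * esym (hd R) * comp_tail (tl R))"
        by (simp add: smult_of_nat rR ac_simps)
    qed
    then show "(\<Sum>R | R \<Turnstile> ?M \<and> ?P (J @ R). ?f (J @ R)) = comp_term J * (reduced_sum a ?M :: 'a mfps)"
      by (simp add: reduced_sum_hd_ge_3 sum_distrib_left)
  qed simp
  finally show ?thesis by (simp add: lollipop_sum_def sum_distrib_right)
qed

section \<open>Triple deletion on the twinned lollipop\<close>

text \<open>The word of a coloring lists its values. The assumption on the edges confines all
  comparisons to positions below \<open>N\<close>, where \<open>restrict (nth xs) {..<N}\<close>
  agrees with the word.\<close>

lemma chromatic_sym_words:
  assumes "\<And>u v. {u, v} \<in> E \<Longrightarrow> u < N \<and> v < N"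
  shows "chromatic_sym ({..<N}, E) = words_gf N (\<lambda>xs. \<forall>u v. {u, v} \<in> E \<longrightarrow> xs ! u \<noteq> xs ! v)"
proof (rule mfps_eqI)
  fix m
  let ?A = "{\<kappa> \<in> proper_colorings ({..<N}, E). monom_of \<kappa> {..<N} = m}"
  let ?B = "{xs. word_monom xs = m \<and> length xs = N \<and> 0 \<notin> set xs
    \<and> (\<forall>u v. {u, v} \<in> E \<longrightarrow> xs ! u \<noteq> xs ! v)}"
  have monom: "word_monom (map \<kappa> [0..<N]) = monom_of \<kappa> {..<N}" for \<kappa>
    by (simp add: word_monom_def monom_of_def o_def interv_sum_list_conv_sum_set_nat atLeast0LessThan)
  have "bij_betw (\<lambda>\<kappa>. map \<kappa> [0..<N]) ?A ?B"
  proof (rule bij_betwI[where g = "\<lambda>xs. restrict (nth xs) {..<N}"])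
    show "(\<lambda>\<kappa>. map \<kappa> [0..<N]) \<in> ?A \<rightarrow> ?B"
    proof
      fix \<kappa> assume \<kappa>: "\<kappa> \<in> ?A"
      then have "0 \<notin> set (map \<kappa> [0..<N])"
        by (auto simp: proper_colorings_def PiE_iff Ball_def)
      with \<kappa> show "map \<kappa> [0..<N] \<in> ?B"
        using assms by (auto simp: monom proper_colorings_def)
    qed
    show "(\<lambda>xs. restrict (nth xs) {..<N}) \<in> ?B \<rightarrow> ?A"
    proof
      fix xs assume xs: "xs \<in> ?B"
      have map: "map (restrict (nth xs) {..<N}) [0..<N] = xs"
        using xs by (auto simp: list_eq_iff_nth_eq)
      have "1 \<le> xs ! i" if "i < N" for i
        using xs that nth_mem[of i xs] by (cases "xs ! i") auto
      then have "restrict (nth xs) {..<N} \<in> {..<N} \<rightarrow>\<^sub>E {1..}"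
        by simp
      moreover have "monom_of (restrict (nth xs) {..<N}) {..<N} = m"
        using xs monom[of "restrict (nth xs) {..<N}"] unfolding map by simp
      ultimately show "restrict (nth xs) {..<N} \<in> ?A"
        using xs assms by (auto simp: proper_colorings_def)
    qed
    show "restrict (nth (map \<kappa> [0..<N])) {..<N} = \<kappa>" if "\<kappa> \<in> ?A" for \<kappa>
    proof
      fix i
      from that have "\<kappa> \<in> extensional {..<N}"
        by (simp add: proper_colorings_def PiE_iff)
      then show "restrict (nth (map \<kappa> [0..<N])) {..<N} i = \<kappa> i"
        by (cases "i < N") (auto simp: extensional_def)
    qed
    show "map (restrict (nth xs) {..<N}) [0..<N] = xs" if "xs \<in> ?B" for xs
      using that by (auto simp: list_eq_iff_nth_eq)
  qed
  then have "card ?A = card ?B" by (rule bij_betw_same_card)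
  then show "mcoeff (chromatic_sym ({..<N}, E)) m =
      mcoeff (words_gf N (\<lambda>xs. \<forall>u v. {u, v} \<in> E \<longrightarrow> xs ! u \<noteq> xs ! v) :: 'a mfps) m"
    by (simp add: chromatic_sym.rep_eq mcoeff_words_gf)
qed

lemma lollipop_word_nth:
  assumes "1 \<le> a" "length xs = a + l"
  shows "lollipop_word a xs \<longleftrightarrow>
    (\<forall>i<a. \<forall>j<a. i \<noteq> j \<longrightarrow> xs ! i \<noteq> xs ! j)
    \<and> (\<forall>j<l. xs ! path_vertex a j \<noteq> xs ! path_vertex a (j + 1))"
proof -
  have "distinct (take a xs) \<longleftrightarrow> (\<forall>i<a. \<forall>j<a. i \<noteq> j \<longrightarrow> xs ! i \<noteq> xs ! j)"
    using assms by (auto simp: distinct_conv_nth)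
  moreover have "distinct_adj (drop (a - 1) xs) \<longleftrightarrow>
      (\<forall>j<l. xs ! path_vertex a j \<noteq> xs ! path_vertex a (j + 1))"
    using assms by (auto simp: distinct_adj_conv_nth path_vertex_def)
  ultimately show ?thesis by (simp add: lollipop_word_def)
qed

lemma lollipop_edge_iff:
  "{u, v} \<in> snd (lollipop a l) \<longleftrightarrow> (u < a \<and> v < a \<and> u \<noteq> v)
    \<or> (\<exists>j<l. u = path_vertex a j \<and> v = path_vertex a (j + 1)
           \<or> v = path_vertex a j \<and> u = path_vertex a (j + 1))"
  by (auto simp: lollipop_def doubleton_eq_iff)

text \<open>The twinned vertex sits at position \<open>a + l - h - 1\<close>. By
  \<open>h < l\<close> it lies outside the clique and by \<open>1 \<le> h\<close> it is not the end
  of the path, so its neighbors are just the two adjacent positions.\<close>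

lemma chromatic_sym_twinned_lollipop:
  assumes "1 \<le> a" "1 \<le> h" "h < l"
  shows "chromatic_sym (twinned_lollipop h a l) = words_gf (a + l + 1) (\<lambda>xs.
    lollipop_word a (take (a + l) xs) \<and> xs ! (a + l) \<noteq> xs ! (a + l - h - 2)
      \<and> xs ! (a + l) \<noteq> xs ! (a + l - h - 1) \<and> xs ! (a + l) \<noteq> xs ! (a + l - h))"
proof -
  define w where "w = path_vertex a (l - h)"
  define E where "E = snd (twinned_lollipop h a l)"
  have w: "w = a + l - h - 1" using assms by (simp add: w_def path_vertex_def)
  have V: "fst (twinned_lollipop h a l) = {..<a + l + 1}"
  proof -
    have "path_vertex a ` {1..l} = {a..<a + l}"
    proof (intro equalityI subsetI)
      fix i assume "i \<in> {a..<a + l}"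
      then show "i \<in> path_vertex a ` {1..l}"
        using assms by (intro image_eqI[of _ _ "i + 1 - a"]) (auto simp: path_vertex_def)
    qed (use assms in \<open>auto simp: path_vertex_def\<close>)
    then show ?thesis by (auto simp: twinned_lollipop_def twin_def lollipop_def)
  qed
  have nbr: "(x = w \<or> {w, x} \<in> snd (lollipop a l)) \<longleftrightarrow> x = w \<or> x = w - 1 \<or> x = w + 1" for x
  proof
    assume "x = w \<or> {w, x} \<in> snd (lollipop a l)"
    then show "x = w \<or> x = w - 1 \<or> x = w + 1"
      using assms unfolding lollipop_edge_iff by (auto simp: w path_vertex_def)
  next
    assume "x = w \<or> x = w - 1 \<or> x = w + 1"
    moreover have "{w, w - 1} \<in> snd (lollipop a l)"
      unfolding lollipop_edge_iff using assms
      by (intro disjI2 exI[of _ "l - h - 1"]) (auto simp: w path_vertex_def)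
    moreover have "{w, w + 1} \<in> snd (lollipop a l)"
      unfolding lollipop_edge_iff using assms
      by (intro disjI2 exI[of _ "l - h"]) (auto simp: w path_vertex_def)
    ultimately show "x = w \<or> {w, x} \<in> snd (lollipop a l)" by auto
  qed
  have E: "E = snd (lollipop a l) \<union> {{a + l, x} | x. x = w \<or> x = w - 1 \<or> x = w + 1}"
    unfolding E_def twinned_lollipop_def twin_def w_def[symmetric] nbr by simp
  have lt: "u < a + l \<and> v < a + l" if "{u, v} \<in> snd (lollipop a l)" for u v
    using that assms unfolding lollipop_edge_iff by (auto simp: path_vertex_def)
  have "u < a + l + 1 \<and> v < a + l + 1" if "{u, v} \<in> E" for u v
    using that lt[of u v] assms unfolding E by (auto simp: doubleton_eq_iff w)
  moreover have "twinned_lollipop h a l = ({..<a + l + 1}, E)"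
    by (simp add: E_def prod_eq_iff V)
  ultimately have "chromatic_sym (twinned_lollipop h a l) =
      (words_gf (a + l + 1) (\<lambda>xs. \<forall>u v. {u, v} \<in> E \<longrightarrow> xs ! u \<noteq> xs ! v) :: 'a mfps)"
    using chromatic_sym_words[of E "a + l + 1"] by simp
  also have "\<dots> = words_gf (a + l + 1) (\<lambda>xs.
    lollipop_word a (take (a + l) xs) \<and> xs ! (a + l) \<noteq> xs ! (a + l - h - 2)
      \<and> xs ! (a + l) \<noteq> xs ! (a + l - h - 1) \<and> xs ! (a + l) \<noteq> xs ! (a + l - h))"
  proof (rule words_gf_cong)
    fix xs :: "nat list" assume len: "length xs = a + l + 1"
    have "(\<forall>u v. {u, v} \<in> snd (lollipop a l) \<longrightarrow> xs ! u \<noteq> xs ! v) \<longleftrightarrow>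
        (\<forall>i<a. \<forall>j<a. i \<noteq> j \<longrightarrow> xs ! i \<noteq> xs ! j)
        \<and> (\<forall>j<l. xs ! path_vertex a j \<noteq> xs ! path_vertex a (j + 1))"
      unfolding lollipop_edge_iff
    proof (intro iffI conjI allI impI)
      fix u v
      assume "(\<forall>i<a. \<forall>j<a. i \<noteq> j \<longrightarrow> xs ! i \<noteq> xs ! j)
          \<and> (\<forall>j<l. xs ! path_vertex a j \<noteq> xs ! path_vertex a (j + 1))"
        and "(u < a \<and> v < a \<and> u \<noteq> v) \<or> (\<exists>j<l. u = path_vertex a j \<and> v = path_vertex a (j + 1)
          \<or> v = path_vertex a j \<and> u = path_vertex a (j + 1))"
      from this(2,1) show "xs ! u \<noteq> xs ! v"
        by (elim disjE exE conjE) (simp_all add: neq_commute)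
    qed blast+
    also have "\<dots> \<longleftrightarrow> lollipop_word a (take (a + l) xs)"
      using assms len by (subst lollipop_word_nth) (auto simp: path_vertex_def)
    finally have "(\<forall>u v. {u, v} \<in> snd (lollipop a l) \<longrightarrow> xs ! u \<noteq> xs ! v) \<longleftrightarrow>
        lollipop_word a (take (a + l) xs)" .
    moreover have "(\<forall>u v. {u, v} \<in> E \<longrightarrow> xs ! u \<noteq> xs ! v) \<longleftrightarrow>
        (\<forall>u v. {u, v} \<in> snd (lollipop a l) \<longrightarrow> xs ! u \<noteq> xs ! v) \<and>
        xs ! (a + l) \<noteq> xs ! w \<and> xs ! (a + l) \<noteq> xs ! (w - 1) \<and> xs ! (a + l) \<noteq> xs ! (w + 1)"
    proof -
      have "{u, v} \<in> E \<longleftrightarrow> {u, v} \<in> snd (lollipop a l)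
          \<or> u = a + l \<and> (v = w \<or> v = w - 1 \<or> v = w + 1)
          \<or> v = a + l \<and> (u = w \<or> u = w - 1 \<or> u = w + 1)" for u v
        unfolding E Un_iff mem_Collect_eq doubleton_eq_iff by blast
      then have "(\<forall>u v. {u, v} \<in> E \<longrightarrow> xs ! u \<noteq> xs ! v) \<longleftrightarrow>
          (\<forall>u v. {u, v} \<in> snd (lollipop a l) \<longrightarrow> xs ! u \<noteq> xs ! v) \<and>
          (\<forall>x. x = w \<or> x = w - 1 \<or> x = w + 1 \<longrightarrow> xs ! (a + l) \<noteq> xs ! x)"
        by metis
      then show ?thesis by blast
    qed
    moreover have "w - 1 = a + l - h - 2" "w + 1 = a + l - h" using assms by (auto simp: w)
    ultimately show "(\<forall>u v. {u, v} \<in> E \<longrightarrow> xs ! u \<noteq> xs ! v) \<longleftrightarrow>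
      lollipop_word a (take (a + l) xs) \<and> xs ! (a + l) \<noteq> xs ! (a + l - h - 2)
      \<and> xs ! (a + l) \<noteq> xs ! (a + l - h - 1) \<and> xs ! (a + l) \<noteq> xs ! (a + l - h)"
      using w by auto
  qed
  finally show ?thesis .
qed

text \<open>Generating function of the words \<open>\<alpha> y u \<beta>\<close>, with \<open>\<alpha>\<close> a lollipop word of length \<open>s\<close> and \<open>\<beta>\<close> a
  path word of length \<open>h\<close>, such that \<open>last \<alpha>, y, u, hd \<beta>\<close> satisfy \<open>R\<close>.\<close>

definition gap_gf :: "nat \<Rightarrow> nat \<Rightarrow> nat \<Rightarrow> (nat \<Rightarrow> nat \<Rightarrow> nat \<Rightarrow> nat \<Rightarrow> bool) \<Rightarrow> 'a::comm_ring_1 mfps" where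
  "gap_gf a s h R = words_gf (s + 2 + h) (\<lambda>xs. lollipop_word a (take s xs)
     \<and> distinct_adj (drop (s + 2) xs) \<and> R (xs ! (s - 1)) (xs ! s) (xs ! (s + 1)) (xs ! (s + 2)))"

text \<open>The outer blocks are the same in all four terms, so an identity in the four colors
  \<open>p\<close>, \<open>y\<close>, \<open>u\<close>, \<open>q\<close> suffices.\<close>

lemma gap_gf_linear:
  assumes "\<And>p y u q. (of_bool (R1 p y u q) + of_bool (R2 p y u q) :: 'a::comm_ring_1) =
      of_bool (R3 p y u q) + of_bool (R4 p y u q)"
  shows "gap_gf a s h R1 + gap_gf a s h R2 = gap_gf a s h R3 + (gap_gf a s h R4 :: 'a mfps)"
proof -
  let ?W = "\<lambda>xs. length xs = s + 2 + h \<and> 0 \<notin> set xs \<and> lollipop_word a (take s xs)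
      \<and> distinct_adj (drop (s + 2) xs)"
  let ?F = "\<lambda>R xs. of_bool (length xs = s + 2 + h \<and> 0 \<notin> set xs \<and> (lollipop_word a (take s xs)
      \<and> distinct_adj (drop (s + 2) xs)
      \<and> R (xs ! (s - 1)) (xs ! s) (xs ! (s + 1)) (xs ! (s + 2)))) :: 'a"
  have "?F R1 xs + ?F R2 xs = ?F R3 xs + ?F R4 xs" for xs
  proof (cases "?W xs")
    case True
    then show ?thesis
      using assms[of "xs ! (s - 1)" "xs ! s" "xs ! (s + 1)" "xs ! (s + 2)"] by simp
  next
    case False
    then have F: "?F R xs = 0" for R by auto
    show ?thesis unfolding F by simp
  qed
  then have "list_gf (\<lambda>xs. ?F R1 xs + ?F R2 xs) = list_gf (\<lambda>xs. ?F R3 xs + ?F R4 xs)"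
    by simp
  then show ?thesis unfolding gap_gf_def words_gf_def list_gf_add .
qed

lemma gap_gf_swap: "1 \<le> s \<Longrightarrow> gap_gf a s h (\<lambda>p y u q. R p u y q) = gap_gf a s h R"
proof -
  let ?p = "\<lambda>xs. lollipop_word a (take s xs)
     \<and> distinct_adj (drop (s + 2) xs) \<and> R (xs ! (s - 1)) (xs ! s) (xs ! (s + 1)) (xs ! (s + 2))"
  assume "1 \<le> s"
  then have "gap_gf a s h (\<lambda>p y u q. R p u y q) =
      words_gf (s + 2 + h) (\<lambda>xs. ?p (swap_at s (s + 1) xs))"
    unfolding gap_gf_def by (intro words_gf_cong) (auto simp: swap_at_def nth_list_update)
  also have "\<dots> = words_gf (s + 2 + h) ?p"
    by (rule words_gf_swap)
  finally show ?thesis by (simp add: gap_gf_def)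
qed

text \<open>Phrasing the hypothesis through \<open>\<alpha> @ y # u # \<beta>\<close> lets the
  append and cons rules for \<open>distinct_adj\<close> replace index arithmetic.\<close>

lemma words_gf_eq_gap_gf:
  assumes "1 \<le> s" "1 \<le> h"
    and "\<And>\<alpha> y u \<beta>. length \<alpha> = s \<Longrightarrow> length \<beta> = h \<Longrightarrow> \<alpha> \<noteq> [] \<Longrightarrow> \<beta> \<noteq> [] \<Longrightarrow>
      f (\<alpha> @ y # u # \<beta>) \<longleftrightarrow> lollipop_word a \<alpha> \<and> distinct_adj \<beta> \<and> R (last \<alpha>) y u (hd \<beta>)"
  shows "words_gf (s + 2 + h) f = gap_gf a s h R"
  unfolding gap_gf_def
proof (rule words_gf_cong)
  fix xs :: "nat list" assume len: "length xs = s + 2 + h"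
  define \<alpha> \<beta> where "\<alpha> = take s xs" and "\<beta> = drop (s + 2) xs"
  have xs: "xs = \<alpha> @ xs ! s # xs ! (s + 1) # \<beta>"
    using len by (simp add: \<alpha>_def \<beta>_def Cons_nth_drop_Suc)
  have len': "length \<alpha> = s" "length \<beta> = h" "\<alpha> \<noteq> []" "\<beta> \<noteq> []"
    using len assms by (auto simp: \<alpha>_def \<beta>_def)
  have "last \<alpha> = \<alpha> ! (s - 1)" using len' by (simp add: last_conv_nth)
  then have "last \<alpha> = xs ! (s - 1)" using assms(1) by (simp add: \<alpha>_def)
  moreover have "hd \<beta> = xs ! (s + 2)"
    using len assms(2) by (simp add: \<beta>_def hd_drop_conv_nth)
  ultimately show "f xs \<longleftrightarrow> lollipop_word a (take s xs) \<and> distinct_adj (drop (s + 2) xs)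
      \<and> R (xs ! (s - 1)) (xs ! s) (xs ! (s + 1)) (xs ! (s + 2))"
    using assms(3)[OF len', of "xs ! s" "xs ! (s + 1)"] unfolding xs[symmetric]
    by (simp add: \<alpha>_def \<beta>_def)
qed

text \<open>Under each relation the graph falls into one lollipop and possibly some paths; the
  factors are its components.\<close>

lemma gap_gf_products:
  fixes a s h :: nat
  assumes "1 \<le> a" "a \<le> s" "1 \<le> h"
  shows "gap_gf a s h (\<lambda>p y u q. p \<noteq> y \<and> y \<noteq> u \<and> u \<noteq> q) =
      (lollipop_gf a (s + 2 + h) :: 'a::comm_ring_1 mfps)"
    and "gap_gf a s h (\<lambda>p y u q. p \<noteq> y \<and> u \<noteq> q) =
      (lollipop_gf a (s + 1) * lollipop_gf 1 (h + 1) :: 'a mfps)"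
    and "gap_gf a s h (\<lambda>p y u q. p \<noteq> y \<and> y \<noteq> q) =
      (lollipop_gf a (s + 1 + h) * lollipop_gf 1 1 :: 'a mfps)"
    and "gap_gf a s h (\<lambda>p y u q. p \<noteq> y \<and> y \<noteq> u) =
      (lollipop_gf a (s + 2) * lollipop_gf 1 h :: 'a mfps)"
    and "gap_gf a s h (\<lambda>p y u q. y \<noteq> u \<and> u \<noteq> q) =
      (lollipop_gf a s * lollipop_gf 1 (h + 2) :: 'a mfps)"
    and "gap_gf a s h (\<lambda>p y u q. y \<noteq> u) =
      (lollipop_gf a s * lollipop_gf 1 2 * lollipop_gf 1 h :: 'a mfps)"
proof -
  have s: "1 \<le> s" using assms by simp
  have app: "lollipop_word a (\<alpha> @ ys) \<longleftrightarrow>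
     lollipop_word a \<alpha> \<and> distinct_adj ys \<and> (ys = [] \<or> last \<alpha> \<noteq> hd ys)" if "length \<alpha> = s" for \<alpha> ys
    using that assms by (intro lollipop_word_append) auto
  have ad: "distinct_adj (x # ys) \<longleftrightarrow> (ys \<noteq> [] \<longrightarrow> x \<noteq> hd ys \<and> distinct_adj ys)" for x :: nat and ys
    by (auto simp: distinct_adj_Cons)
  note gap = words_gf_eq_gap_gf[OF s assms(3), symmetric, where a = a]
  show "gap_gf a s h (\<lambda>p y u q. p \<noteq> y \<and> y \<noteq> u \<and> u \<noteq> q) =
      (lollipop_gf a (s + 2 + h) :: 'a::comm_ring_1 mfps)"
    unfolding lollipop_gf_def by (rule gap) (auto simp: app ad)
  have "words_gf (s + 2 + h) (\<lambda>z. lollipop_word a (take (s + 1) z) \<and> distinct_adj (drop (s + 1) z)) =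
      (lollipop_gf a (s + 1) * lollipop_gf 1 (h + 1) :: 'a mfps)"
    by (simp add: lollipop_gf_def words_gf_mult)
  then show "gap_gf a s h (\<lambda>p y u q. p \<noteq> y \<and> u \<noteq> q) =
      (lollipop_gf a (s + 1) * lollipop_gf 1 (h + 1) :: 'a mfps)"
    by (subst gap[of "\<lambda>z. lollipop_word a (take (s + 1) z) \<and> distinct_adj (drop (s + 1) z)"])
      (auto simp: app ad)
  have "words_gf (s + 2 + h) (\<lambda>z. lollipop_word a (take (s + 2) z) \<and> distinct_adj (drop (s + 2) z)) =
      (lollipop_gf a (s + 2) * lollipop_gf 1 h :: 'a mfps)"
    by (simp add: lollipop_gf_def words_gf_mult)
  then show "gap_gf a s h (\<lambda>p y u q. p \<noteq> y \<and> y \<noteq> u) =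
      (lollipop_gf a (s + 2) * lollipop_gf 1 h :: 'a mfps)"
    by (subst gap[of "\<lambda>z. lollipop_word a (take (s + 2) z) \<and> distinct_adj (drop (s + 2) z)"])
      (auto simp: app ad)
  have "words_gf (s + 2 + h) (\<lambda>z. lollipop_word a (take s z) \<and> distinct_adj (drop s z)) =
      (lollipop_gf a s * lollipop_gf 1 (h + 2) :: 'a mfps)"
    by (simp add: lollipop_gf_def words_gf_mult)
  then show "gap_gf a s h (\<lambda>p y u q. y \<noteq> u \<and> u \<noteq> q) =
      (lollipop_gf a s * lollipop_gf 1 (h + 2) :: 'a mfps)"
    by (subst gap[of "\<lambda>z. lollipop_word a (take s z) \<and> distinct_adj (drop s z)"])
      (auto simp: app ad)
  have "words_gf (s + 2 + h) (\<lambda>z. (lollipop_word a (take s (take (s + 2) z))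
        \<and> distinct_adj (drop s (take (s + 2) z))) \<and> distinct_adj (drop (s + 2) z)) =
      (lollipop_gf a s * lollipop_gf 1 2 * lollipop_gf 1 h :: 'a mfps)"
    unfolding lollipop_gf_def words_gf_mult by simp
  then show "gap_gf a s h (\<lambda>p y u q. y \<noteq> u) =
      (lollipop_gf a s * lollipop_gf 1 2 * lollipop_gf 1 h :: 'a mfps)"
    by (subst gap[of "\<lambda>z. (lollipop_word a (take s (take (s + 2) z))
        \<and> distinct_adj (drop s (take (s + 2) z))) \<and> distinct_adj (drop (s + 2) z)"])
      (auto simp: app ad)
  have "words_gf (s + 2 + h) (\<lambda>z. lollipop_word a (take (s + 1 + h) z) \<and> distinct_adj (drop (s + 1 + h) z)) =
      (lollipop_gf a (s + 1 + h) * lollipop_gf 1 1 :: 'a mfps)"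
    by (simp add: lollipop_gf_def words_gf_mult)
  \<comment> \<open>Here \<open>u\<close> is isolated but stands inside the word, so it is rotated
    to the end.\<close>
  moreover have "gap_gf a s h (\<lambda>p y u q. p \<noteq> y \<and> y \<noteq> q) = (words_gf (s + 2 + h)
      (\<lambda>xs. (\<lambda>z. lollipop_word a (take (s + 1 + h) z) \<and> distinct_adj (drop (s + 1 + h) z))
        (take (s + 1) xs @ rotate1 (drop (s + 1) xs))) :: 'a mfps)"
    by (rule gap) (auto simp: app ad)
  moreover have "\<dots> = words_gf (s + 2 + h)
      (\<lambda>z. lollipop_word a (take (s + 1 + h) z) \<and> distinct_adj (drop (s + 1 + h) z))"
    by (rule words_gf_rotate_drop)
  ultimately show "gap_gf a s h (\<lambda>p y u q. p \<noteq> y \<and> y \<noteq> q) =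
      (lollipop_gf a (s + 1 + h) * lollipop_gf 1 1 :: 'a mfps)"
    by simp
qed

text \<open>Every linear relation below is an instance of triple deletion: among the three colors of a
  triangle with one proper edge, at most one of the two other edges is violated.\<close>

lemma chromatic_sym_twinned_lollipop_expand:
  assumes "1 \<le> a" "1 \<le> h" "h < l"
  defines "s \<equiv> a + l - h - 1"
  shows "chromatic_sym (twinned_lollipop h a l) =
    4 * lollipop_gf a (s + 2 + h) + 2 * (lollipop_gf a (s + 1 + h) * lollipop_gf 1 1)
    - 2 * (lollipop_gf a (s + 1) * lollipop_gf 1 (h + 1))
    - 2 * (lollipop_gf a (s + 2) * lollipop_gf 1 h)
    - 2 * (lollipop_gf a s * lollipop_gf 1 (h + 2))
    + (lollipop_gf a s * lollipop_gf 1 2 * lollipop_gf 1 h :: 'a::comm_ring_1 mfps)"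
proof -
  let ?G = "gap_gf a s h :: _ \<Rightarrow> 'a mfps"
  have s: "1 \<le> s" "a \<le> s" "a + l = s + 1 + h" using assms by auto
  let ?T = "\<lambda>xs. lollipop_word a (take (s + 1 + h) xs) \<and> xs ! (s + 1 + h) \<noteq> xs ! (s - 1)
      \<and> xs ! (s + 1 + h) \<noteq> xs ! s \<and> xs ! (s + 1 + h) \<noteq> xs ! (s + 1)"
  \<comment> \<open>In \<open>?K\<close> the triangle on \<open>y\<close>, \<open>u\<close>,
    \<open>q\<close> is detached from the lollipop; in \<open>?H\<close> it is attached by the edge
    from \<open>p\<close> to \<open>y\<close>; in \<open>?S\<close> the vertex \<open>u\<close> is
    pendant at \<open>y\<close>.\<close>
  let ?K = "?G (\<lambda>p y u q. y \<noteq> u \<and> y \<noteq> q \<and> u \<noteq> q)"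
  let ?H = "?G (\<lambda>p y u q. p \<noteq> y \<and> y \<noteq> u \<and> y \<noteq> q \<and> u \<noteq> q)"
  let ?S = "?G (\<lambda>p y u q. p \<noteq> y \<and> y \<noteq> u \<and> y \<noteq> q)"
  note products = gap_gf_products[OF assms(1) s(2) assms(2), where 'a = 'a]
  have "chromatic_sym (twinned_lollipop h a l) = (words_gf (s + 2 + h) ?T :: 'a mfps)"
    using chromatic_sym_twinned_lollipop[OF assms(1-3), where 'a = 'a]
    unfolding s(3) by simp
  \<comment> \<open>The twin leaves the last position for position \<open>s + 1\<close>, directly
    behind the vertex it copies.\<close>
  also have "\<dots> = words_gf (s + 2 + h) (\<lambda>xs. ?T (take (s + 1) xs @ rotate1 (drop (s + 1) xs)))"
    by (rule words_gf_rotate_drop[symmetric])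
  also have "\<dots> = ?G (\<lambda>p y u q. p \<noteq> y \<and> p \<noteq> u \<and> y \<noteq> u \<and> y \<noteq> q \<and> u \<noteq> q)" (is "_ = ?X")
  proof (rule words_gf_eq_gap_gf[OF s(1) assms(2)])
    fix \<alpha> \<beta> :: "nat list" and y u
    assume len: "length \<alpha> = s" "length \<beta> = h" and ne: "\<alpha> \<noteq> []" "\<beta> \<noteq> []"
    have eq: "take (s + 1) (\<alpha> @ y # u # \<beta>) @ rotate1 (drop (s + 1) (\<alpha> @ y # u # \<beta>)) =
        \<alpha> @ y # \<beta> @ [u]" using len by simp
    have "(\<alpha> @ y # \<beta> @ [u]) ! (s + 1 + h) = u" "(\<alpha> @ y # \<beta> @ [u]) ! (s - 1) = last \<alpha>"
      "(\<alpha> @ y # \<beta> @ [u]) ! s = y" "(\<alpha> @ y # \<beta> @ [u]) ! (s + 1) = hd \<beta>"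
      "take (s + 1 + h) (\<alpha> @ y # \<beta> @ [u]) = \<alpha> @ y # \<beta>"
      using len ne s(1) by (auto simp: nth_append last_conv_nth hd_conv_nth)
    moreover have "lollipop_word a (\<alpha> @ y # \<beta>) \<longleftrightarrow>
        lollipop_word a \<alpha> \<and> distinct_adj \<beta> \<and> y \<noteq> hd \<beta> \<and> last \<alpha> \<noteq> y"
      using len ne s assms(1) by (subst lollipop_word_append) (auto simp: distinct_adj_Cons)
    ultimately show "?T (take (s + 1) (\<alpha> @ y # u # \<beta>) @ rotate1 (drop (s + 1) (\<alpha> @ y # u # \<beta>)))
        \<longleftrightarrow> lollipop_word a \<alpha> \<and> distinct_adj \<beta> \<and> last \<alpha> \<noteq> y \<and> last \<alpha> \<noteq> u \<and> y \<noteq> u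
          \<and> y \<noteq> hd \<beta> \<and> u \<noteq> hd \<beta>"
      unfolding eq by auto
  qed
  finally have "chromatic_sym (twinned_lollipop h a l) = ?X" .
  \<comment> \<open>Deletion at the triangle on \<open>p\<close>, \<open>y\<close>, \<open>u\<close>
    with the edge \<open>y u\<close> kept; the two resulting graphs differ by exchanging
    \<open>y\<close> and \<open>u\<close>.\<close>
  moreover have "?X + ?K = ?H + ?G (\<lambda>p y u q. p \<noteq> u \<and> u \<noteq> y \<and> u \<noteq> q \<and> y \<noteq> q)"
    by (rule gap_gf_linear) auto
  moreover have "?G (\<lambda>p y u q. p \<noteq> u \<and> u \<noteq> y \<and> u \<noteq> q \<and> y \<noteq> q) = ?H"
    using s(1) by (rule gap_gf_swap)
  moreover have "?H + ?G (\<lambda>p y u q. p \<noteq> y \<and> y \<noteq> u) = ?S + ?G (\<lambda>p y u q. p \<noteq> y \<and> y \<noteq> u \<and> u \<noteq> q)"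
    by (rule gap_gf_linear) auto
  \<comment> \<open>This is the difference of the deletions that keep \<open>u q\<close> and
    \<open>y q\<close>; the graph with all three edges cancels.\<close>
  moreover have "?S + ?G (\<lambda>p y u q. p \<noteq> y \<and> u \<noteq> q) =
      ?G (\<lambda>p y u q. p \<noteq> y \<and> y \<noteq> u \<and> u \<noteq> q) + ?G (\<lambda>p y u q. p \<noteq> y \<and> y \<noteq> q)"
    by (rule gap_gf_linear) auto
  moreover have "?K + ?G (\<lambda>p y u q. y \<noteq> u) =
      ?G (\<lambda>p y u q. u \<noteq> y \<and> y \<noteq> q) + ?G (\<lambda>p y u q. y \<noteq> u \<and> u \<noteq> q)"
    by (rule gap_gf_linear) auto
  moreover have "?G (\<lambda>p y u q. u \<noteq> y \<and> y \<noteq> q) = ?G (\<lambda>p y u q. y \<noteq> u \<and> u \<noteq> q)"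
    using s(1) by (rule gap_gf_swap)
  \<comment> \<open>The relations give \<open>?X = 2 * ?H - ?K\<close>, then \<open>?H\<close> in
    terms of \<open>?S\<close>, and finally \<open>?S\<close> and \<open>?K\<close> in terms of
    products.\<close>
  ultimately show ?thesis
    unfolding products eq_diff_eq[symmetric] by (simp add: algebra_simps)
qed

section \<open>The expansion\<close>

text \<open>Splitting \<open>lollipop_sum\<close> at \<open>n\<close> and at \<open>n - 1\<close>
  produces, for each overshoot \<open>t\<close>, the prefix factor times \<open>2 * tail_sum a (n -
  h - t) + esym 1 * tail_sum a (n - h - t - 1)\<close>. By \<open>reduced_sum_eq\<close> the
  subtracted product leaves exactly the reduced tails.\<close>

lemma twinned_lollipop_sum_identity:
  assumes "1 \<le> h" "h + a + 2 \<le> n" "1 \<le> a"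
  shows "2 * (\<Sum>K | K \<in> last_ge_comps a n \<and> 3 \<le> comp_theta K h. comp_term K)
      + esym 1 * (\<Sum>I | I \<in> last_ge_comps a (n - 1) \<and> 3 \<le> comp_theta I h. comp_term I)
      + (lollipop_sum 1 h * reduced_sum a (n - h)
         + lollipop_sum 2 (h + 1) * reduced_sum a (n - h - 1))
      + lollipop_sum 3 (h + 2) * reduced_sum a (n - h - 2) =
    2 * lollipop_sum a n + esym 1 * lollipop_sum a (n - 1)
      - lollipop_sum a (n - h) * lollipop_sum 1 h
      - lollipop_sum a (n - h - 1) * lollipop_sum 1 (h + 1)
      - lollipop_sum a (n - h - 2)
          * (lollipop_sum 1 (h + 2) - esym 2 * lollipop_sum 1 h :: 'a::comm_ring_1 mfps)"
proof -
  \<comment> \<open>The correction in \<open>lollipop_sum_refine\<close> has coefficient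
    \<open>1 - 1\<close> here.\<close>
  have A1: "lollipop_sum 1 (h + 1) = (lollipop_sum 2 (h + 1) :: 'a mfps)"
    using lollipop_sum_refine[of 1 "h + 1", where 'a = 'a] assms by (simp add: numeral_2_eq_2)
  have "lollipop_sum 1 (h + 2) = (lollipop_sum 2 (h + 2) :: 'a mfps)"
    using lollipop_sum_refine[of 1 "h + 2", where 'a = 'a] assms by (simp add: numeral_2_eq_2)
  also have "\<dots> = lollipop_sum 3 (h + 2) + esym 2 * lollipop_sum 1 h"
    using lollipop_sum_refine[of 2 "h + 2", where 'a = 'a] assms by (simp add: numeral_3_eq_3)
  finally have A2: "lollipop_sum 1 (h + 2) - esym 2 * lollipop_sum 1 h = (lollipop_sum 3 (h + 2) :: 'a mfps)"
    by simp
  have idx: "n - 1 - h = n - h - 1" "n - 1 - h - 1 = n - h - 2" "n - h - 1 - 2 = n - h - 3"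
    "n - h - 1 - 1 = n - h - 2" "n - h - 2 - 1 = n - h - 3" by auto
  \<comment> \<open>The boundary case \<open>n - 1 = h + 2\<close> is possible, but
    \<open>h + a + 2 \<le> n\<close> then forces \<open>a \<le> 1\<close>.\<close>
  have hyp: "h + 2 \<le> n" "n = h + 2 \<longrightarrow> a \<le> 1" "h + 2 \<le> n - 1" "n - 1 = h + 2 \<longrightarrow> a \<le> 1"
    using assms by auto
  note red = reduced_sum_eq[of "n - h" a, where 'a = 'a] reduced_sum_eq[of "n - h - 1" a, where 'a = 'a]
    reduced_sum_eq[of "n - h - 2" a, where 'a = 'a]
  have red':
    "reduced_sum a (n - h) = 2 * tail_sum a (n - h) + esym 1 * tail_sum a (n - h - 1)
      - (lollipop_sum a (n - h) :: 'a mfps)"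
    "reduced_sum a (n - h - 1) = 2 * tail_sum a (n - h - 1) + esym 1 * tail_sum a (n - h - 2)
      - (lollipop_sum a (n - h - 1) :: 'a mfps)"
    "reduced_sum a (n - h - 2) = 2 * tail_sum a (n - h - 2) + esym 1 * tail_sum a (n - h - 3)
      - (lollipop_sum a (n - h - 2) :: 'a mfps)"
    unfolding eq_diff_eq using red assms unfolding idx by auto
  have split':
    "lollipop_sum a n = (\<Sum>K | K \<in> last_ge_comps a n \<and> 3 \<le> comp_theta K h. comp_term K)
    + lollipop_sum 1 h * tail_sum a (n - h)
    + lollipop_sum 2 (h + 1) * tail_sum a (n - h - 1)
    + lollipop_sum 3 (h + 2) * (tail_sum a (n - h - 2) :: 'a mfps)"
    "lollipop_sum a (n - 1) = (\<Sum>K | K \<in> last_ge_comps a (n - 1) \<and> 3 \<le> comp_theta K h. comp_term K)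
    + lollipop_sum 1 h * tail_sum a (n - h - 1)
    + lollipop_sum 2 (h + 1) * tail_sum a (n - h - 2)
    + lollipop_sum 3 (h + 2) * (tail_sum a (n - h - 3) :: 'a mfps)"
    using lollipop_sum_split[OF assms(1) hyp(1,2), where 'a = 'a]
      lollipop_sum_split[OF assms(1) hyp(3,4), where 'a = 'a]
    unfolding idx .
  show ?thesis
    unfolding A1 A2 red' split' by (simp only: algebra_simps)
qed

lemma last_ge_comps_eq:
  assumes "1 \<le> N"
  shows "{K. K \<Turnstile> N \<and> part_end K 1 \<ge> a \<and> P K} = {K. K \<in> last_ge_comps a N \<and> P K}"
proof -
  have "K \<noteq> []" if "K \<Turnstile> N" for K using that assms by auto
  then show ?thesis by (auto simp: last_ge_comps_def part_end_last simp del: One_nat_def)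
qed

text \<open>Every product in the expansion has exactly one factor containing the clique, so
  \<open>fact (a - 1)\<close> comes out once. The path on two vertices contributes
  \<open>2 * esym 2\<close>, which makes the last coefficient even as well.\<close>

lemma chromatic_sym_twinned_lollipop_eq:
  assumes "1 \<le> a" "1 \<le> h" "h < l" "n = a + l + 1"
  shows "chromatic_sym (twinned_lollipop h a l) = of_nat (2 * fact (a - 1)) *
    (2 * lollipop_sum a n + esym 1 * lollipop_sum a (n - 1)
      - lollipop_sum a (n - h) * lollipop_sum 1 h
      - lollipop_sum a (n - h - 1) * lollipop_sum 1 (h + 1)
      - lollipop_sum a (n - h - 2)
          * (lollipop_sum 1 (h + 2) - esym 2 * lollipop_sum 1 h :: 'a::field_char_0 mfps))"
proof -
  define s where "s = a + l - h - 1"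
  have idx: "n = s + 2 + h" "n - 1 = s + 1 + h" "n - h = s + 2" "s + 2 - 1 = s + 1" "s + 2 - 2 = s"
    using assms by (auto simp: s_def)
  have as: "a \<le> s" using assms by (simp add: s_def)
  have L: "lollipop_gf a N = of_nat (fact (a - 1)) * (lollipop_sum a N :: 'a mfps)" if "s \<le> N" for N
    using that as assms by (intro lollipop_gf_eq_sum) auto
  have P: "lollipop_gf 1 N = (lollipop_sum 1 N :: 'a mfps)" if "1 \<le> N" for N
    using lollipop_gf_eq_sum[of 1 N, where 'a = 'a] that by simp
  have P1: "lollipop_sum 1 1 = (esym 1 :: 'a mfps)"
    using lollipop_sum_self[of 1, where 'a = 'a] by simp
  have "lollipop_sum 1 2 = (lollipop_sum 2 2 :: 'a mfps)"
    using lollipop_sum_refine[of 1 2, where 'a = 'a] by (simp add: numeral_2_eq_2)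
  then have P2: "lollipop_sum 1 2 = (2 * esym 2 :: 'a mfps)"
    using lollipop_sum_self[of 2, where 'a = 'a] by simp
  have "chromatic_sym (twinned_lollipop h a l) =
    4 * lollipop_gf a (s + 2 + h) + 2 * (lollipop_gf a (s + 1 + h) * lollipop_gf 1 1)
    - 2 * (lollipop_gf a (s + 1) * lollipop_gf 1 (h + 1))
    - 2 * (lollipop_gf a (s + 2) * lollipop_gf 1 h)
    - 2 * (lollipop_gf a s * lollipop_gf 1 (h + 2))
    + (lollipop_gf a s * lollipop_gf 1 2 * lollipop_gf 1 h :: 'a mfps)"
    unfolding s_def by (rule chromatic_sym_twinned_lollipop_expand[OF assms(1-3)])
  also have "\<dots> = 4 * (of_nat (fact (a - 1)) * lollipop_sum a (s + 2 + h))
    + 2 * (of_nat (fact (a - 1)) * lollipop_sum a (s + 1 + h) * esym 1)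
    - 2 * (of_nat (fact (a - 1)) * lollipop_sum a (s + 1) * lollipop_sum 1 (h + 1))
    - 2 * (of_nat (fact (a - 1)) * lollipop_sum a (s + 2) * lollipop_sum 1 h)
    - 2 * (of_nat (fact (a - 1)) * lollipop_sum a s * lollipop_sum 1 (h + 2))
    + of_nat (fact (a - 1)) * lollipop_sum a s * (2 * esym 2) * lollipop_sum 1 h"
    using assms by (simp only: L P P1 P2 le_add1 le_refl order_trans[OF le_add1 le_add1])
  also have "\<dots> = of_nat (2 * fact (a - 1)) *
    (2 * lollipop_sum a (s + 2 + h) + esym 1 * lollipop_sum a (s + 1 + h)
      - lollipop_sum a (s + 2) * lollipop_sum 1 h
      - lollipop_sum a (s + 1) * lollipop_sum 1 (h + 1)
      - lollipop_sum a s * (lollipop_sum 1 (h + 2) - esym 2 * lollipop_sum 1 h))"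
    unfolding of_nat_mult of_nat_numeral
    by (simp add: algebra_simps del: of_nat_fact One_nat_def)
  finally show ?thesis unfolding idx(2-) idx(1)[symmetric] .
qed

theorem theorem4p3:
  fixes a l h n :: nat
  assumes "a \<ge> 1" and "l \<ge> 2" and "1 \<le> h" and "h \<le> l - 1" and "n = a + l + 1"
  shows "(1 / (2 * fact (a - 1)) :: rat) \<odot> chromatic_sym (twinned_lollipop h a l) =
      (\<Sum>K | K \<Turnstile> n \<and> part_end K 1 \<ge> a \<and> comp_theta K h \<ge> 3.
          (2 * of_nat (comp_weight K)) \<odot> esym_comp K)
    + (\<Sum>I | I \<Turnstile> n - 1 \<and> part_end I 1 \<ge> a \<and> comp_theta I h \<ge> 3.
          of_nat (comp_weight I) \<odot> esym_comp (1 # I))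
    + (\<Sum>K | K \<Turnstile> n \<and> length K \<ge> 2 \<and> comp_theta K h \<le> 1 \<and> part_end K 1 \<ge> 3
            \<and> (part_end K 1 + part_end K 2 \<ge> n - h + 1 \<or> part_end K 2 \<ge> a).
          ((of_nat (part_end K 1) - 2) * of_nat (comp_weight (butlast K))) \<odot> esym_comp K)
    + (\<Sum>K | K \<Turnstile> n \<and> part_end K 1 \<ge> a
            \<and> comp_theta K (h + 3) \<ge> comp_theta K h \<and> comp_theta K h = 2.
          ((of_nat (comp_theta K (h + 3)) - 1) / of_nat (comp_theta K (h + 3))
            * of_nat (comp_weight K)) \<odot> esym_comp K)"
    (is "_ = ?S1 + ?S2 + ?S3 + ?S4")
proof -
  have h: "h < l" and n: "h + a + 2 \<le> n" "1 \<le> n" "1 \<le> n - 1" using assms by auto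
  have S1: "?S1 = 2 * (\<Sum>K | K \<in> last_ge_comps a n \<and> 3 \<le> comp_theta K h. comp_term K)"
    unfolding last_ge_comps_eq[OF n(2)] sum_distrib_left
  proof (rule sum.cong[OF refl])
    fix K
    have "(2 * of_nat (comp_weight K) :: rat) = of_nat (2 * comp_weight K)" by simp
    then show "(2 * of_nat (comp_weight K)) \<odot> esym_comp K = 2 * (comp_term K :: rat mfps)"
      by (simp only: smult_of_nat) (simp add: comp_term_def mult.assoc)
  qed
  \<comment> \<open>Prepending 1 multiplies \<open>e_I\<close> by \<open>e_1\<close>, while the
    weight stays that of \<open>I\<close>.\<close>
  have S2: "?S2 = esym 1 * (\<Sum>I | I \<in> last_ge_comps a (n - 1) \<and> 3 \<le> comp_theta I h. comp_term I)"
    unfolding last_ge_comps_eq[OF n(3)] sum_distrib_left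
    by (rule sum.cong) (simp_all add: smult_of_nat comp_term_def esym_comp_def ac_simps)
  have S3: "?S3 = lollipop_sum 1 h * reduced_sum a (n - h)
      + lollipop_sum 2 (h + 1) * reduced_sum a (n - h - 1)"
  proof -
    let ?P = "\<lambda>K. 2 \<le> length K \<and> 3 \<le> part_end K 1
      \<and> (n - h + 1 \<le> part_end K 1 + part_end K 2 \<or> a \<le> part_end K 2)"
    let ?f = "\<lambda>K. of_nat ((part_end K 1 - 2) * comp_weight (butlast K)) * (esym_comp K :: rat mfps)"
    have fin: "finite {K. K \<Turnstile> n \<and> comp_theta K h = t \<and> ?P K}" for t
      by (rule finite_subset[OF _ finite_compositions[of n]]) auto
    have "?S3 = (\<Sum>K | K \<Turnstile> n \<and> length K \<ge> 2 \<and> comp_theta K h \<le> 1 \<and> part_end K 1 \<ge> 3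
            \<and> (part_end K 1 + part_end K 2 \<ge> n - h + 1 \<or> part_end K 2 \<ge> a). ?f K)"
    proof (rule sum.cong[OF refl])
      fix K assume "K \<in> {K. K \<Turnstile> n \<and> length K \<ge> 2 \<and> comp_theta K h \<le> 1 \<and> part_end K 1 \<ge> 3
            \<and> (part_end K 1 + part_end K 2 \<ge> n - h + 1 \<or> part_end K 2 \<ge> a)}"
      \<comment> \<open>Truncated and rational subtraction agree because
        \<open>part_end K 1 \<ge> 3\<close>.\<close>
      then have "(of_nat (part_end K 1) - 2) * of_nat (comp_weight (butlast K)) =
          (of_nat ((part_end K 1 - 2) * comp_weight (butlast K)) :: rat)"
        by (simp add: of_nat_diff)
      then show "((of_nat (part_end K 1) - 2) * of_nat (comp_weight (butlast K))) \<odot> esym_comp K = ?f K"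
        by (simp only: smult_of_nat)
    qed
    also have "\<dots> = (\<Sum>K\<in>{K. K \<Turnstile> n \<and> comp_theta K h = 0 \<and> ?P K}
        \<union> {K. K \<Turnstile> n \<and> comp_theta K h = 1 \<and> ?P K}. ?f K)"
      by (rule sum.cong) (auto simp: le_Suc_eq)
    also have "\<dots> = (\<Sum>K | K \<Turnstile> n \<and> comp_theta K h = 0 \<and> ?P K. ?f K)
        + (\<Sum>K | K \<Turnstile> n \<and> comp_theta K h = 1 \<and> ?P K. ?f K)"
      by (intro sum.union_disjoint fin) auto
    also have "(\<Sum>K | K \<Turnstile> n \<and> comp_theta K h = 0 \<and> ?P K. ?f K) =
        lollipop_sum 1 h * reduced_sum a (n - h)"
      using third_sum_part[OF assms(3) n(1), of 0, where 'a = rat] by simp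
    also have "(\<Sum>K | K \<Turnstile> n \<and> comp_theta K h = 1 \<and> ?P K. ?f K) =
        lollipop_sum 2 (h + 1) * reduced_sum a (n - h - 1)"
      using third_sum_part[OF assms(3) n(1), of 1, where 'a = rat] by (simp add: numeral_2_eq_2)
    finally show ?thesis .
  qed
  have S4: "?S4 = lollipop_sum 3 (h + 2) * reduced_sum a (n - h - 2)"
  proof -
    have "{K. K \<Turnstile> n \<and> part_end K 1 \<ge> a \<and> comp_theta K (h + 3) \<ge> comp_theta K h \<and> comp_theta K h = 2} =
        {K. K \<Turnstile> n \<and> comp_theta K h = 2 \<and> (K \<noteq> [] \<and> a \<le> last K \<and> 2 \<le> comp_theta K (h + 3))}"
      unfolding last_ge_comps_eq[OF n(2)] by (auto simp: last_ge_comps_def)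
    then show ?thesis
      using fourth_sum[OF assms(3) n(1) assms(1), where 'a = rat] by simp
  qed
  define c :: nat where "c = 2 * fact (a - 1)"
  have X: "chromatic_sym (twinned_lollipop h a l) = of_nat c * (?S1 + ?S2 + ?S3 + ?S4)"
    unfolding S1 S2 S3 S4 twinned_lollipop_sum_identity[OF assms(3) n(1) assms(1)] c_def
    by (rule chromatic_sym_twinned_lollipop_eq[OF assms(1,3) h assms(5)])
  have "(1 / (2 * fact (a - 1)) * of_nat c :: rat) = 1"
    by (simp add: c_def)
  moreover have "1 \<odot> f = f" for f :: "rat mfps"
    using smult_of_nat[of 1 f] by simp
  ultimately show ?thesis
    unfolding X smult_mult_of_nat[symmetric] by (simp only:)
qed

end
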